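(* Let $\mathcal G$ be a $d$-rigid graph, let $p^*\in\mathcal C$ be a target configuration and $m^*=F(p^* )$. Let $(\nu,\eta)$ be a compatible formation controller defined on an open neighborhood $V\subseteq\mathcal S$ of $(p^*,m^* )$, where $\nu$ is smooth. Suppose there exist constants $C,c>0$ such that every solution of the closed-loop system $$\dot p=\nu_{(p,m)}(m^*-m),\qquad \dot m=\eta_{(p,m)}(m^*-m)$$ with initial condition $(p^0,m^0)\in V$ satisfies $$\|m(t)-m^*\|\le Ce^{-ct}\|m^0-m^*\|,\qquad t\ge 0 .$$ Then there exists a neighborhood $U\subseteq V$ of $(p^*,m^* )$ such that, for every initial condition $(p^0,m^0)\in U$, there is a configuration $q$ congruent to $p^*$ satisfying $$\|p(t)-q\|\le Ke^{-ct}\|m^0-m^*\|,\qquad t\ge 0,$$ where $K>0$ is independent of the initial condition. In particular, the controller is locally exponentially stable at $p^*$.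
   Context: Fix $d\ge 1$ and a finite simple graph $\mathcal G=(\mathcal V,\mathcal E)$, $\mathcal V=\{1,\dots,n\}$. A configuration is $p=(p_1,\dots,p_n)\in(\mathbb R^d)^n=\mathbb R^{dn}$. The distance map is $F:\mathbb R^{dn}\to\mathbb R^{|\mathcal E|}$, $F(p)=(\|p_j-p_i\|^2)_{ij\in\mathcal E}$. The rigidity matrix $R(p)\in\mathbb R^{|\mathcal E|\times dn}$ has, in the row of edge $ij$, the block $(p_i-p_j)^\top$ at vertex $i$, $(p_j-p_i)^\top$ at vertex $j$, and zeros elsewhere; so $F(p)=R(p)p$ and $\mathrm dF_p=2R(p)$. Configurations are congruent if they differ by a Euclidean isometry of $\mathbb R^d$. Regular values: $m\in F(\mathbb R^{dn})$ is a regular value if near $m$ the image $F(\mathbb R^{dn})$ is a smooth embedded submanifold of $\mathbb R^{|\mathcal E|}$ and $\mathrm dF_p$ maps onto its tangent space at $m$ for every $p\in F^{-1}(m)$. $\mathcal Q$ is the set of regular values, $\mathcal C=F^{-1}(\mathcal Q)$ the set of regular configurations; for $m=F(p)\in\mathcal Q$, $T_m\mathcal Q=\operatorname{im}R(p)$. The graph $\mathcal G$ is $d$-rigid if for every $p\in\mathcal C$ there is a neighborhood of $p$ in which every $q$ with $F(q)=F(p)$ is congruent to $p$. $\mathcal S=\{(p,m)\in\mathcal C\times\mathcal Q: F(p)=m\}$. A compatible formation controller is a pair of linear operators $\nu_{(p,m)}:\mathbb R^{|\mathcal E|}\to\mathbb R^{dn}$, $\eta_{(p,m)}:\mathbb R^{|\mathcal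 E|}\to\mathbb R^{|\mathcal E|}$, depending smoothly on $(p,m)\in\mathcal S$ (or on an open subset of $\mathcal S$ containing the target state), with $(\nu_{(p,m)}x,\eta_{(p,m)}x)\in T_{(p,m)}\mathcal S$ for all $x$, equivalently $\eta_{(p,m)}=2R(p)\nu_{(p,m)}$. The controller is locally exponentially stable at $p^*\in\mathcal C$ if there is a neighborhood $U'\ni p^*$ such that, for all initial conditions $(p^0,F(p^0))$ with $p^0\in U'$, the node trajectory $p(t)$ of the closed-loop system converges exponentially to a configuration $q\in U'$ congruent to $p^*$; exponential convergence means $\|p(t)-q\|\le K'e^{-c't}$ for all $t\ge0$, with constants $K',c'>0$ not depending on $p^0\in U'$. *)

theory Defs
  imports "HOL-Analysis.Analysis"
begin

text \<open>
  Vertices are the elements of a finite linearly ordered type \<open>'v\<close> (playing the role of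
  \<open>{1,...,n}\<close>), the ambient dimension is \<open>CARD('d)\<close>, and the undirected edge between two
  vertices is represented by the unique pair \<open>(i, j)\<close> with \<open>i < j\<close>.
\<close>

type_synonym ('d, 'v) config = "real ^ 'd ^ 'v"
type_synonym 'v meas = "real ^ ('v \<times> 'v)"

definition simple_graph :: "('v::{finite,linorder} \<times> 'v) set \<Rightarrow> bool" where
  "simple_graph E \<longleftrightarrow> (\<forall>(i, j) \<in> E. i < j)"

text \<open>
  The space of real vectors indexed by \<open>E\<close> is the coordinate subspace of vectors supported
  on \<open>E\<close>; this allows \<open>E\<close> to be empty.
\<close>

definition edge_space :: "('v::{finite,linorder} \<times> 'v) set \<Rightarrow> 'v meas set" where
  "edge_space E = {x. \<forall>e. e \<notin> E \<longrightarrow> x $ e = 0}"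

definition dist_map ::
  "('v::{finite,linorder} \<times> 'v) set \<Rightarrow> ('d::finite, 'v) config \<Rightarrow> 'v meas" where
  "dist_map E p = (\<chi> e. if e \<in> E then (norm (p $ snd e - p $ fst e))\<^sup>2 else 0)"

definition rigidity ::
  "('v::{finite,linorder} \<times> 'v) set \<Rightarrow> ('d::finite, 'v) config \<Rightarrow> ('d, 'v) config \<Rightarrow> 'v meas"
  where
  "rigidity E p x = (\<chi> e. if e \<in> E
     then (p $ fst e - p $ snd e) \<bullet> x $ fst e + (p $ snd e - p $ fst e) \<bullet> x $ snd e else 0)"

definition congruent_config ::
  "('d::finite, 'v::finite) config \<Rightarrow> ('d, 'v) config \<Rightarrow> bool" where
  "congruent_config p q \<longleftrightarrow>
     (\<exists>g :: real^'d \<Rightarrow> real^'d. (\<forall>x y. dist (g x) (g y) = dist x y) \<and> (\<forall>i. q $ i = g (p $ i)))"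

text \<open>
  \<open>Ck_on k U f\<close> is meant for open \<open>U\<close>. As the domain is finite-dimensional, continuity of all
  iterated directional derivatives of the (Frechet) derivatives is \<open>k\<close>-fold continuous
  differentiability.
\<close>

primrec Ck_on ::
  "nat \<Rightarrow> 'a::euclidean_space set \<Rightarrow> ('a \<Rightarrow> 'b::real_normed_vector) \<Rightarrow> bool" where
  "Ck_on 0 U f \<longleftrightarrow> continuous_on U f"
| "Ck_on (Suc k) U f \<longleftrightarrow> (\<forall>x\<in>U. f differentiable (at x)) \<and>
     (\<forall>v. Ck_on k U (\<lambda>x. frechet_derivative f (at x) v))"

definition Cinf_on ::
  "'a::euclidean_space set \<Rightarrow> ('a \<Rightarrow> 'b::real_normed_vector) \<Rightarrow> bool" where
  "Cinf_on U f \<longleftrightarrow> (\<forall>k. Ck_on k U f)"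

text \<open>
  Smoothness on an arbitrary subset \<open>A\<close> (in particular on an embedded submanifold): local
  existence of smooth extensions to open sets of the ambient space.
\<close>

definition smooth_on ::
  "'a::euclidean_space set \<Rightarrow> ('a \<Rightarrow> 'b::real_normed_vector) \<Rightarrow> bool" where
  "smooth_on A f \<longleftrightarrow>
     (\<forall>x\<in>A. \<exists>W g. open W \<and> x \<in> W \<and> Cinf_on W g \<and> (\<forall>y \<in> W \<inter> A. g y = f y))"

text \<open>Slice charts of the ambient space.\<close>

definition embedded_submanifold :: "nat \<Rightarrow> 'a::euclidean_space set \<Rightarrow> bool" where
  "embedded_submanifold k M \<longleftrightarrow>
     (\<forall>x\<in>M. \<exists>(W :: 'a set) (W' :: 'a set) \<phi> \<psi> L.
        open W \<and> x \<in> W \<and> open W' \<and> homeomorphism W W' \<phi> \<psi> \<and>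
        Cinf_on W \<phi> \<and> Cinf_on W' \<psi> \<and>
        subspace L \<and> dim L = k \<and> \<phi> ` (M \<inter> W) = W' \<inter> L)"

text \<open>Velocities at \<open>x\<close> of smooth curves in \<open>M\<close>.\<close>

definition tangent_space :: "'a::euclidean_space set \<Rightarrow> 'a \<Rightarrow> 'a set" where
  "tangent_space M x =
     {v. \<exists>(\<gamma> :: real \<Rightarrow> 'a) \<epsilon>. 0 < \<epsilon> \<and> Cinf_on {-\<epsilon><..<\<epsilon>} \<gamma> \<and> \<gamma> ` {-\<epsilon><..<\<epsilon>} \<subseteq> M \<and>
        \<gamma> 0 = x \<and> (\<gamma> has_vector_derivative v) (at 0)}"

text \<open>
  The dimension does not occur in the type of \<open>E\<close>, hence the type argument.
  Being an embedded submanifold of the coordinate subspace \<open>edge_space E\<close> is the same as being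
  one of the full space, so charts and neighbourhoods are taken in the latter.
\<close>

definition regular_values ::
  "'d::finite itself \<Rightarrow> ('v::{finite,linorder} \<times> 'v) set \<Rightarrow> 'v meas set" where
  "regular_values d E =
     {m. m \<in> range (dist_map E :: ('d, 'v) config \<Rightarrow> 'v meas) \<and>
         (\<exists>W k. open W \<and> m \<in> W \<and>
            embedded_submanifold k (range (dist_map E :: ('d, 'v) config \<Rightarrow> 'v meas) \<inter> W) \<and>
            (\<forall>p :: ('d, 'v) config. dist_map E p = m \<longrightarrow>
               range (frechet_derivative (dist_map E) (at p)) =
               tangent_space (range (dist_map E :: ('d, 'v) config \<Rightarrow> 'v meas) \<inter> W) m))}"

definition regular_configs ::
  "('v::{finite,linorder} \<times> 'v) set \<Rightarrow> ('d::finite, 'v) config set" where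
  "regular_configs E = {p. dist_map E p \<in> regular_values TYPE('d) E}"

definition rigid_graph ::
  "'d::finite itself \<Rightarrow> ('v::{finite,linorder} \<times> 'v) set \<Rightarrow> bool" where
  "rigid_graph d E \<longleftrightarrow>
     (\<forall>p \<in> (regular_configs E :: ('d, 'v) config set).
        \<exists>N. open N \<and> p \<in> N \<and>
          (\<forall>q\<in>N. dist_map E q = dist_map E p \<longrightarrow> congruent_config p q))"

definition state_space ::
  "('v::{finite,linorder} \<times> 'v) set \<Rightarrow> (('d::finite, 'v) config \<times> 'v meas) set" where
  "state_space E =
     {(p, m). p \<in> regular_configs E \<and> m \<in> regular_values TYPE('d) E \<and> dist_map E p = m}"

text \<open>
  Operators on \<open>edge_space E\<close> are given by operators on the full space, whose values
  outside \<open>edge_space E\<close> are irrelevant (any operator extends, by composing it with the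
  coordinate projection). Since the second components of points of \<open>state_space E\<close> lie in
  \<open>edge_space E\<close>, tangency forces \<open>\<eta>\<close> to map \<open>edge_space E\<close> to itself.
\<close>

definition compatible_controller ::
  "('v::{finite,linorder} \<times> 'v) set \<Rightarrow> (('d::finite, 'v) config \<times> 'v meas) set \<Rightarrow>
   (('d, 'v) config \<times> 'v meas \<Rightarrow> 'v meas \<Rightarrow>\<^sub>L ('d, 'v) config) \<Rightarrow>
   (('d, 'v) config \<times> 'v meas \<Rightarrow> 'v meas \<Rightarrow>\<^sub>L 'v meas) \<Rightarrow> bool" where
  "compatible_controller E V \<nu> \<eta> \<longleftrightarrow>
     openin (top_of_set (state_space E)) V \<and> smooth_on V \<nu> \<and> smooth_on V \<eta> \<and>
     (\<forall>s\<in>V. \<forall>x \<in> edge_space E.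
        (blinfun_apply (\<nu> s) x, blinfun_apply (\<eta> s) x) \<in> tangent_space (state_space E) s)"

text \<open>
  Solutions of the closed-loop system on the interval \<open>[0, T)\<close>, where \<open>T\<close> may be infinite.
  They stay in the domain \<open>V\<close> of the controller.
\<close>

definition closed_loop_solution ::
  "(('d::finite, 'v::{finite,linorder}) config \<times> 'v meas \<Rightarrow> 'v meas \<Rightarrow>\<^sub>L ('d, 'v) config) \<Rightarrow>
   (('d, 'v) config \<times> 'v meas \<Rightarrow> 'v meas \<Rightarrow>\<^sub>L 'v meas) \<Rightarrow>
   (('d, 'v) config \<times> 'v meas) set \<Rightarrow> 'v meas \<Rightarrow> ereal \<Rightarrow>
   (real \<Rightarrow> ('d, 'v) config) \<Rightarrow> (real \<Rightarrow> 'v meas) \<Rightarrow> bool" where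
  "closed_loop_solution \<nu> \<eta> V mstar T p m \<longleftrightarrow>
     (\<forall>t \<in> {t. 0 \<le> t \<and> ereal t < T}.
        (p t, m t) \<in> V \<and>
        (p has_vector_derivative blinfun_apply (\<nu> (p t, m t)) (mstar - m t))
          (at t within {t. 0 \<le> t \<and> ereal t < T}) \<and>
        (m has_vector_derivative blinfun_apply (\<eta> (p t, m t)) (mstar - m t))
          (at t within {t. 0 \<le> t \<and> ereal t < T}))"

definition locally_exp_stable ::
  "('v::{finite,linorder} \<times> 'v) set \<Rightarrow> (('d::finite, 'v) config \<times> 'v meas) set \<Rightarrow>
   (('d, 'v) config \<times> 'v meas \<Rightarrow> 'v meas \<Rightarrow>\<^sub>L ('d, 'v) config) \<Rightarrow>
   (('d, 'v) config \<times> 'v meas \<Rightarrow> 'v meas \<Rightarrow>\<^sub>L 'v meas) \<Rightarrow> ('d, 'v) config \<Rightarrow> bool" where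
  "locally_exp_stable E V \<nu> \<eta> pstar \<longleftrightarrow>
     pstar \<in> regular_configs E \<and>
     (\<exists>U' K' c'. open U' \<and> pstar \<in> U' \<and> 0 < K' \<and> 0 < c' \<and>
        (\<forall>p0\<in>U'.
           (\<exists>p m. closed_loop_solution \<nu> \<eta> V (dist_map E pstar) \<infinity> p m \<and>
              p 0 = p0 \<and> m 0 = dist_map E p0) \<and>
           (\<forall>p m. closed_loop_solution \<nu> \<eta> V (dist_map E pstar) \<infinity> p m \<and>
              p 0 = p0 \<and> m 0 = dist_map E p0 \<longrightarrow>
              (\<exists>q\<in>U'. congruent_config pstar q \<and>
                 (\<forall>t\<ge>0. norm (p t - q) \<le> K' * exp (- c' * t))))))"

text \<open>Agreement of the distance map and its derivative with the rigidity matrix.\<close>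

lemma dist_map_eq_rigidity: "dist_map E p = rigidity E p p"
  by (simp add: dist_map_def rigidity_def vec_eq_iff power2_norm_eq_inner inner_diff_left
      inner_diff_right inner_commute)

lemma dist_map_has_derivative:
  "(dist_map E has_derivative (\<lambda>x. 2 *\<^sub>R rigidity E p x)) (at p)"
proof -
  have "((\<lambda>p. dist_map E p $ e) has_derivative (\<lambda>x. (2 *\<^sub>R rigidity E p x) $ e)) (at p)" for e
  proof (cases "e \<in> E")
    case True
    have "((\<lambda>p. (p $ snd e - p $ fst e) \<bullet> (p $ snd e - p $ fst e)) has_derivative
        (\<lambda>x. (p $ snd e - p $ fst e) \<bullet> (x $ snd e - x $ fst e) +
             (x $ snd e - x $ fst e) \<bullet> (p $ snd e - p $ fst e))) (at p)"
      by (intro derivative_intros bounded_linear.has_derivative[OF bounded_linear_vec_nth])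
    moreover have "(\<lambda>x. (p $ snd e - p $ fst e) \<bullet> (x $ snd e - x $ fst e) +
             (x $ snd e - x $ fst e) \<bullet> (p $ snd e - p $ fst e)) =
        (\<lambda>x. (2 *\<^sub>R rigidity E p x) $ e)"
      using True by (auto simp: rigidity_def algebra_simps inner_commute)
    ultimately show ?thesis
      using True by (simp add: dist_map_def power2_norm_eq_inner)
  qed (simp add: dist_map_def rigidity_def)
  then have "((\<lambda>p. \<chi> e. dist_map E p $ e) has_derivative
      (\<lambda>x. \<chi> e. (2 *\<^sub>R rigidity E p x) $ e)) (at p)"
    by (subst has_derivative_componentwise_within)
      (auto simp: Basis_vec_def inner_axis)
  then show ?thesis by (simp only: vec_nth_inverse)
qed

end

theory Submission
  imports Defs
begin

text \<open>
  Near the target the controller is bounded, say by \<open>M\<close>, so the speed of the configuration is at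
  most \<open>M\<close> times the measurement error, hence at most \<open>M C exp (- c t) \<parallel>m0 - mstar\<parallel>\<close>
  (\<open>closed_loop_travel_bound\<close>). Integrating, the configuration travels at most
  \<open>K exp (- c t) \<parallel>m0 - mstar\<parallel>\<close> after time \<open>t\<close>, where \<open>K = M C / c\<close>. If the initial
  measurement error is small compared with the distance to the boundary of a ball around the target,
  the trajectory cannot leave the ball (\<open>stays_in_ball\<close>) and converges exponentially to some
  configuration \<open>q\<close> in it. By continuity \<open>q\<close> has the target distances, and if the ball is small
  enough, rigidity makes \<open>q\<close> congruent to the target.

  Two points need work. First, a differential equation on the state space has solutions only if they
  do not run into its boundary, so one has to know that configurations close to a regular one are
  regular (\<open>regular_values_relatively_open\<close>). The rank of the rigidity matrix is lower
  semicontinuous, but regularity of a value involves all configurations in its fibre, and fibres are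
  unbounded; compactness is recovered by replacing configurations by their edge vectors
  (\<open>rank_dist_map_near_fibre\<close>). Slice charts provide the matching upper bound on the dimension of
  tangent spaces (\<open>embedded_submanifold_tangent\<close>).

  Second, trajectories have to exist for all times. The vector field is Lipschitz on a ball around
  the target (\<open>controller_lipschitz_near\<close>); composed with the projection to the ball it is
  globally Lipschitz, so that the extended equation has global solutions
  (\<open>lipschitz_ode_global_solution\<close>). As long as such a solution is inside the ball it solves the
  closed loop, so the decay hypothesis applies to it and keeps it inside the ball.
\<close>

section \<open>Smooth maps and embedded submanifolds\<close>

lemma Ck_on_cong:
  assumes "open U" and "\<And>x. x \<in> U \<Longrightarrow> f x = g x"
  shows "Ck_on k U f \<longleftrightarrow> Ck_on k U g"
  using assms(2)
proof (induction k arbitrary: f g)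
  case 0
  then show ?case by (simp cong: continuous_on_cong)
next
  case (Suc k)
  have deriv: "(f has_derivative D) (at x) \<longleftrightarrow> (g has_derivative D) (at x)" if "x \<in> U" for x D
    using Suc.prems that \<open>open U\<close> by (metis has_derivative_transform_within_open)
  have "f differentiable (at x) \<longleftrightarrow> g differentiable (at x)" if "x \<in> U" for x
    using deriv[OF that] by (simp add: differentiable_def)
  moreover have "frechet_derivative f (at x) = frechet_derivative g (at x)" if "x \<in> U" for x
    using deriv[OF that] by (simp add: frechet_derivative_def)
  ultimately show ?case by (simp add: Suc.IH[where f = "\<lambda>x. frechet_derivative f (at x) v"
        and g = "\<lambda>x. frechet_derivative g (at x) v" for v])
qed

lemma Ck_on_compose_line:
  fixes f :: "'a::euclidean_space \<Rightarrow> 'b::real_normed_vector"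
  assumes "open J" and "Ck_on k U f" and "\<And>t. t \<in> J \<Longrightarrow> a + t *\<^sub>R l \<in> U"
  shows "Ck_on k (J :: real set) (\<lambda>t. f (a + t *\<^sub>R l))"
  using assms(2)
proof (induction k arbitrary: f)
  case 0
  then show ?case
    using assms(3) by (auto intro!: continuous_on_compose2[where f = "\<lambda>t. a + t *\<^sub>R l"] continuous_intros)
next
  case (Suc k)
  have deriv: "((\<lambda>t. f (a + t *\<^sub>R l)) has_derivative 
      (\<lambda>v. frechet_derivative f (at (a + t *\<^sub>R l)) (v *\<^sub>R l))) (at t)" if "t \<in> J" for t
  proof (rule has_derivative_compose[where f = "\<lambda>t. a + t *\<^sub>R l"])
    show "((\<lambda>t. a + t *\<^sub>R l) has_derivative (\<lambda>v. v *\<^sub>R l)) (at t)"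
      by (auto intro!: derivative_eq_intros)
    show "(f has_derivative frechet_derivative f (at (a + t *\<^sub>R l))) (at (a + t *\<^sub>R l))"
      using Suc.prems assms(3)[OF that] by (simp add: frechet_derivative_works)
  qed
  have "Ck_on k J (\<lambda>t. frechet_derivative (\<lambda>t. f (a + t *\<^sub>R l)) (at t) v)" for v
  proof -
    have "Ck_on k J (\<lambda>t. frechet_derivative f (at (a + t *\<^sub>R l)) (v *\<^sub>R l))"
      using Suc.IH[of "\<lambda>x. frechet_derivative f (at x) (v *\<^sub>R l)"] Suc.prems by simp
    then show ?thesis
      by (subst Ck_on_cong[OF \<open>open J\<close>]) (auto simp: frechet_derivative_at[OF deriv, symmetric])
  qed
  moreover have "(\<lambda>t. f (a + t *\<^sub>R l)) differentiable (at t)" if "t \<in> J" for t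
    using deriv[OF that] by (auto simp: differentiable_def)
  ultimately show ?case by simp
qed

lemma Cinf_on_compose_line:
  fixes f :: "'a::euclidean_space \<Rightarrow> 'b::real_normed_vector"
  assumes "open J" and "Cinf_on U f" and "\<And>t. t \<in> J \<Longrightarrow> a + t *\<^sub>R l \<in> U"
  shows "Cinf_on (J :: real set) (\<lambda>t. f (a + t *\<^sub>R l))"
  using assms Ck_on_compose_line unfolding Cinf_on_def by blast

lemma Cinf_on_imp_differentiable:
  assumes "Cinf_on U f" "x \<in> U"
  shows "(f has_derivative frechet_derivative f (at x)) (at x)"
proof -
  have "Ck_on (Suc 0) U f" using assms(1) unfolding Cinf_on_def by blast
  then show ?thesis using assms(2) by (simp add: frechet_derivative_works)
qed

lemma Cinf_on_quadratic_curve: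
  fixes a b q :: "'a::real_normed_vector"
  shows "Cinf_on (J :: real set) (\<lambda>t. a + t *\<^sub>R b + t\<^sup>2 *\<^sub>R q)"
proof -
  have "Ck_on k J (\<lambda>t. a + t *\<^sub>R b + t\<^sup>2 *\<^sub>R q)" for k
  proof (induction k arbitrary: a b q)
    case 0
    show ?case by (auto intro!: continuous_intros)
  next
    case (Suc k)
    have deriv: "((\<lambda>t::real. a + t *\<^sub>R b + t\<^sup>2 *\<^sub>R q) has_derivative
        (\<lambda>v. v *\<^sub>R b + t *\<^sub>R ((2 * v) *\<^sub>R q) + t\<^sup>2 *\<^sub>R 0)) (at t)" for t
      by (auto intro!: derivative_eq_intros simp: algebra_simps)
    have "(\<lambda>t. a + t *\<^sub>R b + t\<^sup>2 *\<^sub>R q) differentiable (at t)" for t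
      using deriv differentiable_def by blast
    moreover have "Ck_on k J (\<lambda>t. v *\<^sub>R b + t *\<^sub>R ((2 * v) *\<^sub>R q) + t\<^sup>2 *\<^sub>R 0)" for v
      by (rule Suc.IH)
    ultimately show ?case
      unfolding Ck_on.simps frechet_derivative_at[OF deriv, symmetric] by blast
  qed
  then show ?thesis by (simp add: Cinf_on_def)
qed

text \<open>
  Bounding the partial derivatives on the compact ball bounds the operator norm of the derivative,
  without knowing that the derivative is continuous as an operator-valued map.
\<close>

lemma C1_lipschitz_on_cball:
  fixes f :: "'a::euclidean_space \<Rightarrow> 'b::real_normed_vector"
  assumes "Ck_on 1 U f" and sub: "cball z r \<subseteq> U"
  shows "\<exists>L. L-lipschitz_on (cball z r) f"
proof -
  define D where "D x = frechet_derivative f (at x)" for x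
  have deriv: "(f has_derivative D x) (at x)" if "x \<in> U" for x
    using assms(1) that by (simp add: D_def frechet_derivative_works)
  have cont: "continuous_on U (\<lambda>x. D x v)" for v
    using assms(1) by (simp add: D_def)
  have "\<exists>B. \<forall>x\<in>cball z r. norm (D x b) \<le> B" for b
  proof -
    have "compact ((\<lambda>x. D x b) ` cball z r)"
      by (intro compact_continuous_image continuous_on_subset[OF cont sub]) simp
    then show ?thesis using compact_imp_bounded bounded_iff by (metis imageI)
  qed
  then obtain B where B: "\<And>b x. x \<in> cball z r \<Longrightarrow> norm (D x b) \<le> B b" by metis
  define L where "L = (\<Sum>b\<in>Basis. \<bar>B b\<bar>)"
  have "onorm (D x) \<le> L" if x: "x \<in> cball z r" for x
  proof (rule onorm_le)
    fix v
    have lin: "linear (D x)" using deriv x sub has_derivative_linear by blast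
    have "D x v = D x (\<Sum>b\<in>Basis. (v \<bullet> b) *\<^sub>R b)"
      by (simp add: euclidean_representation)
    also have "\<dots> = (\<Sum>b\<in>Basis. (v \<bullet> b) *\<^sub>R D x b)"
      by (simp add: linear_sum[OF lin] linear_cmul[OF lin])
    finally have "norm (D x v) = norm (\<Sum>b\<in>Basis. (v \<bullet> b) *\<^sub>R D x b)" by (rule arg_cong)
    also have "\<dots> \<le> (\<Sum>b\<in>Basis. \<bar>v \<bullet> b\<bar> * norm (D x b))"
      by (rule order_trans[OF norm_sum]) simp
    also have "\<dots> \<le> (\<Sum>b\<in>Basis. norm v * \<bar>B b\<bar>)"
      using B[OF x] by (intro sum_mono mult_mono) (auto simp: Basis_le_norm intro: order_trans[OF _ abs_ge_self])
    finally show "norm (D x v) \<le> L * norm v"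
      by (simp add: L_def sum_distrib_left mult.commute)
  qed
  then have "norm (f x - f y) \<le> L * norm (x - y)" if "x \<in> cball z r" "y \<in> cball z r" for x y
    using that sub by (intro differentiable_bound[OF convex_cball, where f' = D])
      (auto intro!: has_derivative_at_withinI deriv)
  then have "L-lipschitz_on (cball z r) f"
    by (intro lipschitz_onI) (auto simp: dist_norm L_def sum_nonneg)
  then show ?thesis ..
qed

lemma curve_in_subspace_derivative:
  fixes x :: "real \<Rightarrow> 'a::euclidean_space"
  assumes "subspace L" and deriv: "(x has_vector_derivative v) (at 0)"
    and L: "\<forall>\<^sub>F t in at 0. x t \<in> L" "x 0 \<in> L"
  shows "v \<in> L"
proof -
  have "((\<lambda>t. (1 / t) *\<^sub>R (x t - x 0)) \<longlongrightarrow> v) (at 0)"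
  proof (rule LIM_zero_cancel, rule tendsto_norm_zero_cancel, rule Lim_transform_eventually)
    show "((\<lambda>t. norm (x t - x 0 - t *\<^sub>R v) / norm t) \<longlongrightarrow> 0) (at 0)"
      using deriv by (simp add: has_vector_derivative_def has_derivative_iff_norm)
    have "norm (x t - x 0 - t *\<^sub>R v) / norm t = norm ((1 / t) *\<^sub>R (x t - x 0) - v)"
      if "t \<noteq> 0" for t
    proof -
      have "(1 / t) *\<^sub>R (x t - x 0) - v = (1 / t) *\<^sub>R (x t - x 0 - t *\<^sub>R v)"
        using that by (simp add: algebra_simps)
      then show ?thesis by simp
    qed
    then show "\<forall>\<^sub>F t in at 0. norm (x t - x 0 - t *\<^sub>R v) / norm t = norm ((1 / t) *\<^sub>R (x t - x 0) - v)"
      by (simp add: eventually_at_filter)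
  qed
  moreover have "closed L" using assms(1) by (rule closed_subspace)
  moreover have "\<forall>\<^sub>F t in at 0. (1 / t) *\<^sub>R (x t - x 0) \<in> L"
    using L(1) by eventually_elim (intro subspace_scale subspace_diff assms(1) L(2))
  ultimately show ?thesis by (intro Lim_in_closed_set[of L _ "at 0"]) auto
qed

text \<open>
  With \<open>tangent_space\<close> defined by curves, it is not evident that it is a subspace. A single slice
  chart \<open>\<phi>\<close> with inverse \<open>\<psi>\<close> gives what is needed: curves \<open>\<psi> (\<phi> m + t l)\<close> show that the
  tangent space at \<open>m\<close> contains a \<open>k\<close>-dimensional subspace, and at all points of the chart
  domain the derivative of \<open>\<phi>\<close> maps tangent vectors into the slice \<open>L\<close>, so tangent spaces are
  contained in \<open>k\<close>-dimensional subspaces. The first bound is used at the point \<open>m\<close> alone, the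
  second one at all nearby points.
\<close>

lemma embedded_submanifold_tangent:
  fixes M :: "'a::euclidean_space set"
  assumes "embedded_submanifold k M" and "m \<in> M"
  obtains S N where "subspace S" "dim S = k" "S \<subseteq> tangent_space M m"
    and "open N" "m \<in> N"
    and "\<And>m'. m' \<in> M \<inter> N \<Longrightarrow> \<exists>S'. subspace S' \<and> dim S' \<le> k \<and> tangent_space M m' \<subseteq> S'"
proof -
  obtain W and W' :: "'a set" and \<phi> \<psi> L where W: "open W" "m \<in> W" "open W'"
    and hom: "homeomorphism W W' \<phi> \<psi>" and smooth: "Cinf_on W \<phi>" "Cinf_on W' \<psi>"
    and L: "subspace L" "dim L = k" "\<phi> ` (M \<inter> W) = W' \<inter> L"
    using assms(1)[unfolded embedded_submanifold_def, rule_format, OF assms(2)] by (elim exE conjE) (rule that)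
  have inv: "\<psi> (\<phi> x) = x" "\<phi> x \<in> W'" if "x \<in> W" for x
    using hom that by (auto simp: homeomorphism_def)
  have inv': "\<phi> (\<psi> y) = y" "\<psi> y \<in> W" if "y \<in> W'" for y
    using hom that by (auto simp: homeomorphism_def)
  define D\<phi> where "D\<phi> x = frechet_derivative \<phi> (at x)" for x
  define D\<psi> where "D\<psi> y = frechet_derivative \<psi> (at y)" for y
  have D\<phi>: "(\<phi> has_derivative D\<phi> x) (at x)" if "x \<in> W" for x
    using Cinf_on_imp_differentiable[OF smooth(1) that] by (simp add: D\<phi>_def)
  have D\<psi>: "(\<psi> has_derivative D\<psi> y) (at y)" if "y \<in> W'" for y
    using Cinf_on_imp_differentiable[OF smooth(2) that] by (simp add: D\<psi>_def)
  have D_inv: "D\<psi> (\<phi> x) (D\<phi> x v) = v" if "x \<in> W" for x v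
  proof -
    have "((\<lambda>x. \<psi> (\<phi> x)) has_derivative (\<lambda>v. D\<psi> (\<phi> x) (D\<phi> x v))) (at x)"
      using has_derivative_compose D\<phi> D\<psi> inv that by blast
    then have "((\<lambda>x. x) has_derivative (\<lambda>v. D\<psi> (\<phi> x) (D\<phi> x v))) (at x)"
      by (rule has_derivative_transform_within_open[OF _ W(1) that]) (simp add: inv)
    then show ?thesis using has_derivative_unique[OF _ has_derivative_ident] by metis
  qed
  have D_inv': "D\<phi> (\<psi> y) (D\<psi> y v) = v" if "y \<in> W'" for y v
  proof -
    have "((\<lambda>x. \<phi> (\<psi> x)) has_derivative (\<lambda>v. D\<phi> (\<psi> y) (D\<psi> y v))) (at y)"
      using has_derivative_compose D\<phi> D\<psi> inv' that by blast
    then have "((\<lambda>x. x) has_derivative (\<lambda>v. D\<phi> (\<psi> y) (D\<psi> y v))) (at y)"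
      by (rule has_derivative_transform_within_open[OF _ W(3) that]) (simp add: inv')
    then show ?thesis using has_derivative_unique[OF _ has_derivative_ident] by metis
  qed
  define S where "S = D\<psi> (\<phi> m) ` L"
  have lin\<psi>: "linear (D\<psi> (\<phi> m))" using D\<psi> W inv has_derivative_linear by blast
  have "inj (D\<psi> (\<phi> m))" using D_inv'[OF inv(2)[OF W(2)]] by (metis injI)
  then have "dim S = k"
    unfolding S_def using L(2) dim_image_eq[OF lin\<psi>] by (simp add: inj_on_subset)
  have "subspace S" unfolding S_def by (intro linear_subspace_image lin\<psi> L)
  have "S \<subseteq> tangent_space M m"
  proof
    fix v assume "v \<in> S"
    then obtain l where l: "l \<in> L" "v = D\<psi> (\<phi> m) l" by (auto simp: S_def)
    have \<phi>m: "\<phi> m \<in> W' \<inter> L" using L W assms(2) by blast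
    define J where "J = (\<lambda>t::real. \<phi> m + t *\<^sub>R l) -` W'"
    have "open J" unfolding J_def by (intro open_vimage W continuous_intros)
    moreover have "0 \<in> J" using \<phi>m by (simp add: J_def)
    ultimately obtain \<epsilon> where \<epsilon>: "0 < \<epsilon>" "ball 0 \<epsilon> \<subseteq> J" by (metis open_contains_ball)
    then have J: "\<phi> m + t *\<^sub>R l \<in> W'" if "t \<in> {-\<epsilon><..<\<epsilon>}" for t
      using that by (force simp: J_def dist_real_def)
    have "\<psi> (\<phi> m + t *\<^sub>R l) \<in> M" if "t \<in> {-\<epsilon><..<\<epsilon>}" for t
    proof -
      have "\<phi> m + t *\<^sub>R l \<in> W' \<inter> L"
        using J[OF that] \<phi>m l L(1) by (auto intro: subspace_add subspace_scale)
      then show ?thesis using L(3) inv by (metis Int_iff imageE)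
    qed
    moreover have "Cinf_on {-\<epsilon><..<\<epsilon>} (\<lambda>t. \<psi> (\<phi> m + t *\<^sub>R l))"
      using J by (intro Cinf_on_compose_line[OF _ smooth(2)]) auto
    moreover have "((\<lambda>t. \<psi> (\<phi> m + t *\<^sub>R l)) has_vector_derivative v) (at 0)"
    proof -
      have "((\<lambda>t. \<psi> (\<phi> m + t *\<^sub>R l)) has_derivative (\<lambda>s. D\<psi> (\<phi> m) (s *\<^sub>R l))) (at 0)"
        by (rule has_derivative_compose[where f = "\<lambda>t. \<phi> m + t *\<^sub>R l"])
          (use D\<psi> \<phi>m in \<open>auto intro!: derivative_eq_intros\<close>)
      then show ?thesis
        by (simp add: has_vector_derivative_def l linear_cmul[OF lin\<psi>])
    qed
    ultimately show "v \<in> tangent_space M m"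
      unfolding tangent_space_def using \<epsilon>(1) inv(1)[OF W(2)]
      by (intro CollectI exI[of _ "\<lambda>t. \<psi> (\<phi> m + t *\<^sub>R l)"] exI[of _ \<epsilon>]) auto
  qed
  have upper: "\<exists>S'. subspace S' \<and> dim S' \<le> k \<and> tangent_space M m' \<subseteq> S'" if m': "m' \<in> M \<inter> W" for m'
  proof (intro exI conjI)
    have lin\<phi>: "linear (D\<phi> m')" using D\<phi> m' has_derivative_linear by blast
    have lin\<psi>': "linear (D\<psi> (\<phi> m'))" using D\<psi> inv m' has_derivative_linear by blast
    show "subspace (D\<psi> (\<phi> m') ` L)" by (intro linear_subspace_image lin\<psi>' L)
    show "dim (D\<psi> (\<phi> m') ` L) \<le> k" using dim_image_le[OF lin\<psi>'] L(2) by metis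
    show "tangent_space M m' \<subseteq> D\<psi> (\<phi> m') ` L"
    proof
      fix v assume "v \<in> tangent_space M m'"
      then obtain \<gamma> \<epsilon> where \<gamma>: "0 < \<epsilon>" "\<gamma> ` {-\<epsilon><..<\<epsilon>} \<subseteq> M" "\<gamma> 0 = m'"
        "(\<gamma> has_vector_derivative v) (at 0)"
        unfolding tangent_space_def by blast
      have "((\<lambda>t. \<phi> (\<gamma> t)) has_derivative (\<lambda>s. D\<phi> m' (s *\<^sub>R v))) (at 0)"
      proof (rule has_derivative_compose[where f = \<gamma> and f' = "\<lambda>s. s *\<^sub>R v" and g' = "D\<phi> m'"])
        show "(\<gamma> has_derivative (\<lambda>s. s *\<^sub>R v)) (at 0)"
          using \<gamma>(4) by (simp add: has_vector_derivative_def)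
        show "(\<phi> has_derivative D\<phi> m') (at (\<gamma> 0))"
          using \<gamma>(3) D\<phi> m' by blast
      qed
      then have "((\<lambda>t. \<phi> (\<gamma> t)) has_vector_derivative D\<phi> m' v) (at 0)"
        by (simp add: has_vector_derivative_def linear_cmul[OF lin\<phi>])
      then have "D\<phi> m' v \<in> L"
      proof (rule curve_in_subspace_derivative[OF L(1)])
        have in_L: "\<phi> x \<in> L" if "x \<in> M" "x \<in> W" for x using L(3) that by blast
        then show "\<phi> (\<gamma> 0) \<in> L" using \<gamma>(3) m' by simp
        have "isCont \<gamma> 0" using \<gamma>(4) has_vector_derivative_continuous by blast
        then have "\<forall>\<^sub>F t in at 0. \<gamma> t \<in> W"
          using W(1) \<gamma>(3) m' by (intro topological_tendstoD[of \<gamma> "\<gamma> 0"]) (auto simp: isCont_def)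
        moreover have "\<forall>\<^sub>F t in at 0. t \<in> {-\<epsilon><..<\<epsilon>}"
          using \<gamma>(1) by (intro eventually_at_in_open') auto
        ultimately show "\<forall>\<^sub>F t in at 0. \<phi> (\<gamma> t) \<in> L"
          by eventually_elim (use in_L \<gamma>(2) in blast)
      qed
      moreover have "v = D\<psi> (\<phi> m') (D\<phi> m' v)" using D_inv m' by simp
      ultimately show "v \<in> D\<psi> (\<phi> m') ` L" by blast
    qed
  qed
  show ?thesis
    using that[OF \<open>subspace S\<close> \<open>dim S = k\<close> \<open>S \<subseteq> tangent_space M m\<close> W(1,2) upper] by blast
qed

lemma lipschitz_on_blinfun_apply:
  fixes A :: "'a::metric_space \<Rightarrow> 'b::real_normed_vector \<Rightarrow>\<^sub>L 'c::real_normed_vector"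
  assumes A: "La-lipschitz_on S A" "\<And>x. x \<in> S \<Longrightarrow> norm (A x) \<le> Ma"
    and b: "Lb-lipschitz_on S b" "\<And>x. x \<in> S \<Longrightarrow> norm (b x) \<le> Mb"
    and "0 \<le> Ma" "0 \<le> Mb"
  shows "(La * Mb + Ma * Lb)-lipschitz_on S (\<lambda>x. blinfun_apply (A x) (b x))"
proof (rule lipschitz_onI)
  have L: "0 \<le> La" "0 \<le> Lb" using A b lipschitz_on_nonneg by blast+
  then show "0 \<le> La * Mb + Ma * Lb" using assms by simp
  fix x y assume x: "x \<in> S" and y: "y \<in> S"
  have "A x (b x) - A y (b y) = (A x - A y) (b x) + A y (b x - b y)"
    by (simp add: blinfun.diff_left blinfun.diff_right)
  then have "dist (A x (b x)) (A y (b y)) \<le> norm ((A x - A y) (b x)) + norm (A y (b x - b y))"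
    by (simp add: dist_norm norm_triangle_ineq)
  also have "\<dots> \<le> norm (A x - A y) * norm (b x) + norm (A y) * norm (b x - b y)"
    by (intro add_mono norm_blinfun)
  also have "\<dots> \<le> (La * dist x y) * Mb + Ma * (Lb * dist x y)"
    using lipschitz_onD[OF A(1) x y] lipschitz_onD[OF b(1) x y] A(2)[OF y] b(2)[OF x] L assms(5,6)
    by (intro add_mono mult_mono) (auto simp: dist_norm)
  finally show "dist (A x (b x)) (A y (b y)) \<le> (La * Mb + Ma * Lb) * dist x y"
    by (simp add: algebra_simps)
qed

section \<open>The distance map and its regular values\<close>

text \<open>
  Both the distance map and its derivative depend on the configuration only through these edge
  vectors. Passing to them removes the translations (one for every connected component of the
  graph), which are what keeps the fibres of the distance map from being compact.
\<close>

definition edge_diff ::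
  "('v::{finite,linorder} \<times> 'v) set \<Rightarrow> ('d::finite, 'v) config \<Rightarrow> real ^ 'd ^ ('v \<times> 'v)" where
  "edge_diff E p = (\<chi> e. if e \<in> E then p $ snd e - p $ fst e else 0)"

definition entrywise_inner :: "real ^ 'd::finite ^ 'e::finite \<Rightarrow> real ^ 'd ^ 'e \<Rightarrow> real ^ 'e" where
  "entrywise_inner y z = (\<chi> e. y $ e \<bullet> z $ e)"

lemma linear_edge_diff: "linear (edge_diff E)"
  by (rule linearI) (auto simp: edge_diff_def vec_eq_iff algebra_simps)

lemma bounded_bilinear_entrywise_inner: "bounded_bilinear entrywise_inner"
  unfolding bilinear_conv_bounded_bilinear[symmetric] bilinear_def
  by (auto intro!: linearI simp: entrywise_inner_def vec_eq_iff inner_add_left inner_add_right)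

lemma dist_map_conv_edge_diff: "dist_map E p = entrywise_inner (edge_diff E p) (edge_diff E p)"
  by (simp add: dist_map_def edge_diff_def entrywise_inner_def vec_eq_iff power2_norm_eq_inner)

lemma rigidity_conv_edge_diff: "rigidity E p x = entrywise_inner (edge_diff E p) (edge_diff E x)"
  by (simp add: rigidity_def edge_diff_def entrywise_inner_def vec_eq_iff inner_diff_left inner_diff_right)

lemma frechet_derivative_dist_map:
  "frechet_derivative (dist_map E) (at p) =
    (\<lambda>x. 2 *\<^sub>R entrywise_inner (edge_diff E p) (edge_diff E x))"
  unfolding rigidity_conv_edge_diff[symmetric]
  by (rule frechet_derivative_at[OF dist_map_has_derivative, symmetric])

text \<open>
  If \<open>S\<close> is a linear right inverse of \<open>\<beta> y\<close> on the range \<open>T\<close> of \<open>\<beta> y\<close>, then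
  \<open>\<beta> y' \<circ> S\<close> is within \<open>1/2\<close> of the identity on \<open>T\<close> for \<open>y'\<close> close to \<open>y\<close>, hence
  injective on \<open>T\<close>.
\<close>

lemma rank_lower_semicontinuous:
  fixes \<beta> :: "'a::real_normed_vector \<Rightarrow> 'b::euclidean_space \<Rightarrow> 'c::euclidean_space"
  assumes "bounded_bilinear \<beta>"
  shows "\<exists>\<delta>>0. \<forall>y'. norm (y' - y) < \<delta> \<longrightarrow> dim (range (\<beta> y)) \<le> dim (range (\<beta> y'))"
proof -
  interpret bounded_bilinear \<beta> by fact
  have lin: "linear (\<beta> z)" for z
    by (rule bounded_linear.linear[OF bounded_linear_right])
  define T where "T = range (\<beta> y)"
  have T: "subspace T" unfolding T_def by (intro linear_subspace_image lin) simp
  obtain S where S: "linear S" "\<And>w. w \<in> T \<Longrightarrow> \<beta> y (S w) = w"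
    using linear_exists_right_inverse_on[OF lin[of y], of UNIV] by (auto simp: T_def)
  obtain b where b: "0 < b" "\<And>w. norm (S w) \<le> b * norm w"
    using linear_bounded_pos[OF S(1)] by blast
  obtain K where K: "0 < K" "\<And>z x. norm (\<beta> z x) \<le> norm z * norm x * K"
    using pos_bounded by blast
  have "dim T \<le> dim (range (\<beta> y'))" if y': "norm (y' - y) < 1 / (2 * K * b)" for y'
  proof -
    have linS: "linear (\<beta> y' \<circ> S)" by (intro linear_compose S lin)
    have "w = 0" if w: "w \<in> T" "\<beta> y' (S w) = 0" for w
    proof -
      have "norm w = norm (\<beta> (y' - y) (S w))"
        using S(2)[OF w(1)] w(2) by (simp add: diff_left)
      also have "\<dots> \<le> norm (y' - y) * (b * norm w) * K"
        using K b by (intro order_trans[OF K(2)] mult_right_mono mult_left_mono) auto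
      also have "\<dots> = norm (y' - y) * (K * b) * norm w" by simp
      also have "\<dots> \<le> 1/2 * norm w"
        using y' K(1) b(1) by (intro mult_right_mono) (auto simp: field_simps)
      finally show ?thesis by simp
    qed
    then have "inj_on (\<beta> y' \<circ> S) T"
      using linear_injective_on_subspace_0[OF linS T] by simp
    then have "dim T = dim ((\<beta> y' \<circ> S) ` T)"
      using dim_image_eq[OF linS, of T] T by (simp add: span_eq_iff[THEN iffD2])
    also have "\<dots> \<le> dim (range (\<beta> y'))" by (intro dim_subset) auto
    finally show ?thesis .
  qed
  then show ?thesis using K b by (intro exI[of _ "1 / (2 * K * b)"]) (auto simp: T_def)
qed

text \<open>
  Regularity of a value is a condition on the whole fibre, so semicontinuity of the rank at a single
  configuration does not suffice. Given configurations \<open>p n\<close> of low rank whose values tend to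
  \<open>m\<close>, their edge vectors are bounded because the edge lengths are; since the space of edge
  vectors of configurations is closed, a limit point comes from a configuration in the fibre over
  \<open>m\<close>, and semicontinuity there gives a contradiction. The configurations themselves need not
  have a limit point.
\<close>

lemma rank_dist_map_near_fibre:
  fixes E :: "('v::{finite,linorder} \<times> 'v) set"
  assumes "\<And>p :: ('d::finite, 'v) config. dist_map E p = m \<Longrightarrow>
    k \<le> dim (range (frechet_derivative (dist_map E) (at p)))"
  shows "\<exists>N. open N \<and> m \<in> N \<and> (\<forall>p :: ('d, 'v) config. dist_map E p \<in> N \<longrightarrow>
    k \<le> dim (range (frechet_derivative (dist_map E) (at p))))"
proof (rule ccontr)
  assume contra: "\<not> ?thesis"
  define \<beta> :: "real ^ 'd ^ ('v \<times> 'v) \<Rightarrow> ('d, 'v) config \<Rightarrow> 'v meas"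
    where "\<beta> y x = 2 *\<^sub>R entrywise_inner y (edge_diff E x)" for y x
  interpret entrywise_inner: bounded_bilinear "entrywise_inner :: real ^ 'd ^ ('v \<times> 'v) \<Rightarrow> _"
    by (rule bounded_bilinear_entrywise_inner)
  have lin: "linear (edge_diff E :: ('d, 'v) config \<Rightarrow> _)" by (rule linear_edge_diff)
  have "bounded_bilinear \<beta>"
    unfolding \<beta>_def bilinear_conv_bounded_bilinear[symmetric] bilinear_def
    by (auto intro!: linearI simp: entrywise_inner.add_left entrywise_inner.add_right
        entrywise_inner.scaleR_left entrywise_inner.scaleR_right scaleR_add_right
        linear_add[OF lin] linear_cmul[OF lin])
  note semicont = rank_lower_semicontinuous[OF this]
  have d\<beta>: "frechet_derivative (dist_map E) (at p) = \<beta> (edge_diff E p)" for p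
    by (simp add: frechet_derivative_dist_map \<beta>_def fun_eq_iff)
  have "\<exists>p :: ('d, 'v) config. dist_map E p \<in> ball m (1 / Suc n) \<and> dim (range (\<beta> (edge_diff E p))) < k" for n
  proof (rule ccontr)
    assume "\<not> ?thesis"
    then have "open (ball m (1 / Suc n)) \<and> m \<in> ball m (1 / Suc n) \<and>
      (\<forall>p :: ('d, 'v) config. dist_map E p \<in> ball m (1 / Suc n) \<longrightarrow>
         k \<le> dim (range (frechet_derivative (dist_map E) (at p))))"
      unfolding d\<beta> by (auto simp: not_less simp del: mem_ball)
    then show False using contra by blast
  qed
  then obtain p :: "nat \<Rightarrow> ('d, 'v) config" where
    p: "\<And>n. dist_map E (p n) \<in> ball m (1 / Suc n)" and
    low: "\<And>n. dim (range (\<beta> (edge_diff E (p n)))) < k"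
    by metis
  have lim: "(\<lambda>n. dist_map E (p n)) \<longlonglongrightarrow> m"
  proof (rule metric_tendsto_imp_tendsto[of "\<lambda>n. 1 / Suc n" 0])
    show "(\<lambda>n. 1 / real (Suc n)) \<longlonglongrightarrow> 0" by (rule LIMSEQ_Suc[OF lim_1_over_n])
    show "\<forall>\<^sub>F n in sequentially. dist (dist_map E (p n)) m \<le> dist (1 / real (Suc n)) 0"
      using p by (intro always_eventually allI) (simp add: dist_commute less_imp_le)
  qed
  define y where "y n = edge_diff E (p n)" for n
  have "(norm z)\<^sup>2 = (\<Sum>e\<in>UNIV. entrywise_inner z z $ e)" for z :: "real ^ 'd ^ ('v \<times> 'v)"
    by (simp add: power2_norm_eq_inner inner_vec_def entrywise_inner_def)
  then have norm_y: "(norm (y n))\<^sup>2 = (\<Sum>e\<in>UNIV. dist_map E (p n) $ e)" for n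
    by (simp add: y_def dist_map_conv_edge_diff)
  have "(\<lambda>n. (norm (y n))\<^sup>2) \<longlonglongrightarrow> (\<Sum>e\<in>UNIV. m $ e)"
    unfolding norm_y by (intro tendsto_sum tendsto_vec_nth lim)
  then have "convergent (\<lambda>n. (norm (y n))\<^sup>2)" by (rule convergentI)
  then have "Bseq (\<lambda>n. (norm (y n))\<^sup>2)" by (rule convergent_imp_Bseq)
  then obtain B where B: "\<And>n. (norm (y n))\<^sup>2 \<le> B" unfolding Bseq_def by auto
  then have "norm (y n) \<le> sqrt B" for n by (simp add: real_le_rsqrt)
  then have "y n \<in> cball 0 (sqrt B)" for n by simp
  then obtain y0 r where r: "strict_mono r" and y0: "(y \<circ> r) \<longlonglongrightarrow> y0"
    using compact_cball[of "0 :: real ^ 'd ^ ('v \<times> 'v)" "sqrt B"]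
    unfolding compact_def by (metis (no_types, lifting))
  have "closed (range (edge_diff E :: ('d, 'v) config \<Rightarrow> _))"
    by (intro closed_subspace linear_subspace_image lin) simp
  then have "y0 \<in> range (edge_diff E :: ('d, 'v) config \<Rightarrow> _)"
    by (rule closed_sequentially[OF _ _ y0]) (simp add: y_def)
  then obtain p0 :: "('d, 'v) config" where p0: "y0 = edge_diff E p0" by blast
  have "(\<lambda>n. entrywise_inner (y (r n)) (y (r n))) \<longlonglongrightarrow> entrywise_inner y0 y0"
    using y0 by (intro entrywise_inner.tendsto) (auto simp: comp_def)
  moreover have "(\<lambda>n. entrywise_inner (y (r n)) (y (r n))) \<longlonglongrightarrow> m"
    using LIMSEQ_subseq_LIMSEQ[OF lim r] by (simp add: y_def dist_map_conv_edge_diff comp_def)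
  ultimately have "dist_map E p0 = m"
    using LIMSEQ_unique by (auto simp: dist_map_conv_edge_diff p0)
  then have "k \<le> dim (range (\<beta> y0))" using assms[of p0] by (simp add: d\<beta> p0)
  moreover obtain \<delta> where \<delta>: "0 < \<delta>"
    "\<And>y'. norm (y' - y0) < \<delta> \<Longrightarrow> dim (range (\<beta> y0)) \<le> dim (range (\<beta> y'))"
    using semicont by blast
  moreover obtain n where "norm (y (r n) - y0) < \<delta>"
    using LIMSEQ_D[OF y0 \<delta>(1)] by auto
  ultimately have "k \<le> dim (range (\<beta> (y (r n))))" by (meson order_trans)
  then show False using low[of "r n"] by (simp add: y_def)
qed

text \<open>
  Along a line \<open>p + t x\<close> the distance map is a quadratic polynomial in \<open>t\<close>.
\<close>

lemma range_derivative_subset_tangent: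
  fixes p :: "('d::finite, 'v::{finite,linorder}) config"
  assumes "open W" "dist_map E p \<in> W"
  shows "range (frechet_derivative (dist_map E) (at p)) \<subseteq>
    tangent_space (range (dist_map E :: ('d, 'v) config \<Rightarrow> _) \<inter> W) (dist_map E p)"
proof
  fix w assume "w \<in> range (frechet_derivative (dist_map E) (at p))"
  then obtain x where w: "w = 2 *\<^sub>R entrywise_inner (edge_diff E p) (edge_diff E x)"
    by (auto simp: frechet_derivative_dist_map)
  define q where "q = entrywise_inner (edge_diff E x) (edge_diff E x)"
  define \<gamma> where "\<gamma> t = dist_map E p + t *\<^sub>R w + t\<^sup>2 *\<^sub>R q" for t
  have \<gamma>: "\<gamma> t = dist_map E (p + t *\<^sub>R x)" for t
    by (simp add: \<gamma>_def w q_def dist_map_conv_edge_diff linear_add[OF linear_edge_diff]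
        linear_cmul[OF linear_edge_diff])
       (simp add: entrywise_inner_def vec_eq_iff inner_add_left inner_add_right inner_commute
        power2_eq_square algebra_simps)
  have "continuous_on UNIV \<gamma>" unfolding \<gamma>_def by (intro continuous_intros)
  then have "open (\<gamma> -` W)" using \<open>open W\<close> open_vimage by blast
  moreover have "0 \<in> \<gamma> -` W" using assms by (simp add: \<gamma>_def)
  ultimately obtain \<epsilon> where \<epsilon>: "0 < \<epsilon>" "ball 0 \<epsilon> \<subseteq> \<gamma> -` W" by (metis open_contains_ball)
  have "\<gamma> ` {-\<epsilon><..<\<epsilon>} \<subseteq> W" using \<epsilon>(2) by (force simp: dist_real_def)
  moreover have "range \<gamma> \<subseteq> range (dist_map E :: ('d, 'v) config \<Rightarrow> _)" using \<gamma> by auto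
  moreover have "Cinf_on {-\<epsilon><..<\<epsilon>} \<gamma>" unfolding \<gamma>_def by (rule Cinf_on_quadratic_curve)
  moreover have "(\<gamma> has_vector_derivative w) (at 0)"
    unfolding \<gamma>_def has_vector_derivative_def by (auto intro!: derivative_eq_intros)
  ultimately show "w \<in> tangent_space (range (dist_map E :: ('d, 'v) config \<Rightarrow> _) \<inter> W) (dist_map E p)"
    unfolding tangent_space_def using \<epsilon>(1)
    by (intro CollectI exI[of _ \<gamma>] exI[of _ \<epsilon>]) (auto simp: \<gamma>_def)
qed

text \<open>
  Over points near \<open>m\<close>, the range of the derivative at any configuration of the fibre is
  contained in the tangent space, which is contained in a space of dimension at most \<open>k\<close>, while
  by the previous lemmas the range has dimension at least \<open>k\<close>; so all three coincide.
\<close>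

lemma regular_values_relatively_open:
  fixes E :: "('v::{finite,linorder} \<times> 'v) set"
  assumes "m \<in> regular_values TYPE('d::finite) E"
  shows "\<exists>N. open N \<and> m \<in> N \<and>
    (\<forall>p :: ('d, 'v) config. dist_map E p \<in> N \<longrightarrow> dist_map E p \<in> regular_values TYPE('d) E)"
proof -
  let ?F = "dist_map E :: ('d, 'v) config \<Rightarrow> 'v meas"
  obtain W k where m: "m \<in> range ?F" and W: "open W" "m \<in> W"
    and emb: "embedded_submanifold k (range ?F \<inter> W)"
    and onto: "\<And>p :: ('d, 'v) config. ?F p = m \<Longrightarrow>
      range (frechet_derivative ?F (at p)) = tangent_space (range ?F \<inter> W) m"
    using assms unfolding regular_values_def by blast
  obtain S N1 where S: "subspace S" "dim S = k" "S \<subseteq> tangent_space (range ?F \<inter> W) m"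
    and N1: "open N1" "m \<in> N1"
    and upper: "\<And>m'. m' \<in> range ?F \<inter> W \<inter> N1 \<Longrightarrow>
      \<exists>S'. subspace S' \<and> dim S' \<le> k \<and> tangent_space (range ?F \<inter> W) m' \<subseteq> S'"
    using embedded_submanifold_tangent[OF emb] m W(2) by blast
  have "k \<le> dim (range (frechet_derivative ?F (at p)))" if "?F p = m" for p
    using onto[OF that] S by (metis dim_subset)
  from rank_dist_map_near_fibre[OF this]
  obtain N2 where N2: "open N2" "m \<in> N2"
    and rank: "\<And>p. ?F p \<in> N2 \<Longrightarrow> k \<le> dim (range (frechet_derivative ?F (at p)))"
    by blast
  have "?F p \<in> regular_values TYPE('d) E" if p: "?F p \<in> W \<inter> N1 \<inter> N2" for p
  proof -
    have "range (frechet_derivative ?F (at q)) = tangent_space (range ?F \<inter> W) (?F p)"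
      if q: "?F q = ?F p" for q
    proof -
      obtain S' where S': "subspace S'" "dim S' \<le> k" "tangent_space (range ?F \<inter> W) (?F p) \<subseteq> S'"
        using upper[of "?F p"] p by blast
      have sub: "range (frechet_derivative ?F (at q)) \<subseteq> tangent_space (range ?F \<inter> W) (?F p)"
        using range_derivative_subset_tangent[of W E q] W p q by simp
      have "linear (frechet_derivative ?F (at q))"
        using dist_map_has_derivative frechet_derivative_works has_derivative_linear
        by (metis differentiable_def)
      then have "subspace (range (frechet_derivative ?F (at q)))"
        by (rule linear_subspace_image) simp
      then have "range (frechet_derivative ?F (at q)) = S'"
        using S' sub rank[of q] p q by (intro subspace_dim_equal) auto
      then show ?thesis using sub S' by blast
    qed
    then show ?thesis
      unfolding regular_values_def using emb W(1) p by blast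
  qed
  then show ?thesis
    using W N1 N2 by (intro exI[of _ "W \<inter> N1 \<inter> N2"]) auto
qed

text \<open>
  The state space lies on the graph of the distance map, so the measurement part of a tangent vector
  is the derivative applied to the configuration part. This expresses compatibility as
  \<open>\<eta> = 2 R(p) \<nu>\<close>.
\<close>

lemma tangent_state_space:
  fixes s :: "('d::finite, 'v::{finite,linorder}) config \<times> 'v meas"
  assumes "(u, w) \<in> tangent_space (state_space E) s"
    and deriv: "(dist_map E has_derivative D) (at (fst s))"
  shows "w = D u"
proof -
  obtain \<gamma> \<epsilon> where \<gamma>: "0 < \<epsilon>" "\<gamma> ` {-\<epsilon><..<\<epsilon>} \<subseteq> state_space E" "\<gamma> 0 = s"
    "(\<gamma> has_vector_derivative (u, w)) (at 0)"
    using assms(1) unfolding tangent_space_def by blast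
  have fst: "((\<lambda>t. fst (\<gamma> t)) has_vector_derivative u) (at 0)"
    using bounded_linear.has_vector_derivative[OF bounded_linear_fst \<gamma>(4)] by simp
  have snd: "((\<lambda>t. snd (\<gamma> t)) has_vector_derivative w) (at 0)"
    using bounded_linear.has_vector_derivative[OF bounded_linear_snd \<gamma>(4)] by simp
  have "((\<lambda>t. dist_map E (fst (\<gamma> t))) has_derivative (\<lambda>h. D (h *\<^sub>R u))) (at 0)"
  proof (rule has_derivative_compose[where f = "\<lambda>t. fst (\<gamma> t)" and f' = "\<lambda>h. h *\<^sub>R u" and g' = D])
    show "((\<lambda>t. fst (\<gamma> t)) has_derivative (\<lambda>h. h *\<^sub>R u)) (at 0)"
      using fst by (simp add: has_vector_derivative_def)
    show "(dist_map E has_derivative D) (at (fst (\<gamma> 0)))" using deriv \<gamma>(3) by simp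
  qed
  then have "((\<lambda>t. dist_map E (fst (\<gamma> t))) has_vector_derivative D u) (at 0)"
    by (simp add: has_vector_derivative_def linear_cmul[OF has_derivative_linear[OF deriv]])
  then have "((\<lambda>t. snd (\<gamma> t)) has_vector_derivative D u) (at 0)"
    by (rule has_vector_derivative_transform_within_open[where S = "{-\<epsilon><..<\<epsilon>}"])
      (use \<gamma>(1,2) in \<open>auto simp: state_space_def image_subset_iff split: prod.splits\<close>)
  then show ?thesis using snd vector_derivative_unique_at by blast
qed

lemma continuous_on_dist_map: "continuous_on S (dist_map E)"
  using dist_map_has_derivative has_derivative_continuous has_derivative_at_withinI
  by (metis continuous_on_eq_continuous_within)

lemma dist_map_lipschitz_on_cball:
  fixes p :: "('d::finite, 'v::{finite,linorder}) config"
  shows "\<exists>L. L-lipschitz_on (cball p r) (dist_map E)"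
proof (rule C1_lipschitz_on_cball[of UNIV])
  interpret bounded_bilinear entrywise_inner by (rule bounded_bilinear_entrywise_inner)
  have "continuous_on UNIV (edge_diff E :: ('d, 'v) config \<Rightarrow> _)"
    by (intro linear_continuous_on linear_conv_bounded_linear[THEN iffD1] linear_edge_diff)
  then have "continuous_on UNIV (\<lambda>q. 2 *\<^sub>R entrywise_inner (edge_diff E q) (edge_diff E v))"
    for v :: "('d, 'v) config"
    by (intro continuous_intros continuous_on)
  moreover have "dist_map E differentiable (at q)" for q :: "('d, 'v) config"
    using dist_map_has_derivative differentiable_def by blast
  ultimately show "Ck_on 1 UNIV (dist_map E :: ('d, 'v) config \<Rightarrow> _)"
    by (simp add: frechet_derivative_dist_map)
qed simp

section \<open>Global solutions and a priori bounds\<close>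

text \<open>
  Picard iteration, run on the whole half-line at once: with \<open>x t = x0 + exp (a t) y t\<close> the
  integral equation becomes a fixed-point equation for a bounded continuous \<open>y\<close>, and the weight
  makes it a contraction by \<open>1/2\<close> as soon as \<open>a\<close> is at least twice the Lipschitz constant.
  Hence no gluing of local solutions is needed.
\<close>

lemma lipschitz_ode_global_solution:
  fixes g :: "'a::euclidean_space \<Rightarrow> 'a"
  assumes "L-lipschitz_on UNIV g"
  shows "\<exists>x. x 0 = x0 \<and> (\<forall>t\<ge>0. (x has_vector_derivative g (x t)) (at t within {0..}))"
proof -
  define a where "a = 2 * (L + 1)"
  have L: "0 \<le> L" using assms lipschitz_on_nonneg by blast
  then have a: "0 < a" "L / a \<le> 1/2" by (auto simp: a_def field_simps)
  have g_cont: "continuous_on UNIV g" using assms by (rule lipschitz_on_continuous_on)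
  define I where "I y t = integral {0..t} (\<lambda>u. g (x0 + exp (a * u) *\<^sub>R apply_bcontfun y u))"
    for y :: "real \<Rightarrow>\<^sub>C 'a" and t :: real
  \<comment> \<open>Bounded continuous functions are taken on the whole real line, so negative times are
    collapsed to \<open>0\<close>.\<close>
  define P where "P y t = exp (- a * max t 0) *\<^sub>R I y (max t 0)" for y t
  have integrand_cont: "continuous_on S (\<lambda>u. g (x0 + exp (a * u) *\<^sub>R apply_bcontfun y u))" for y S
    by (rule continuous_on_compose2[OF g_cont]) (auto intro!: continuous_intros)
  have I_deriv: "(I y has_vector_derivative g (x0 + exp (a * t) *\<^sub>R apply_bcontfun y t)) (at t within {0..})"
    if "0 \<le> t" for y t
  proof -
    have "(I y has_vector_derivative g (x0 + exp (a * t) *\<^sub>R apply_bcontfun y t)) (at t within {0..t+1})"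
      unfolding I_def using that by (intro integral_has_vector_derivative integrand_cont) auto
    moreover have "at t within {0..t+1} = at t within {0..}"
      by (rule at_within_nhd[of t "{..<t+1}"]) (auto simp: that)
    ultimately show ?thesis by simp
  qed
  have P_cont: "continuous_on UNIV (P y)" for y
  proof -
    have "continuous_on {0..} (I y)"
      by (auto simp: continuous_on_eq_continuous_within
          intro!: has_vector_derivative_continuous I_deriv)
    then have "continuous_on UNIV (\<lambda>t. I y (max t 0))"
      by (rule continuous_on_compose2) (auto intro!: continuous_intros)
    then show ?thesis unfolding P_def by (intro continuous_intros)
  qed
  have P_diff: "norm (P y t - P z t) \<le> 1/2 * dist y z" for y z t
  proof -
    define s where "s = max t 0"
    have "norm (I y s - I z s) \<le> L * dist y z * (exp (a * s) / a - exp (a * 0) / a)"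
    proof -
      have "norm (I y s - I z s - (I y 0 - I z 0)) 
         \<le> L * dist y z * (exp (a * s) / a) - L * dist y z * (exp (a * 0) / a)"
      proof (cases "s = 0")
        case False
        then have "0 < s" by (simp add: s_def max_def split: if_splits)
        then show ?thesis
        proof (rule differentiable_bound_general)
          show "continuous_on {0..s} (\<lambda>t. I y t - I z t)"
            unfolding I_def by (intro continuous_intros indefinite_integral_continuous_1
                integrable_continuous_interval integrand_cont)
          show "continuous_on {0..s} (\<lambda>t. L * dist y z * (exp (a * t) / a))"
            using a by (intro continuous_intros) auto
          fix u assume u: "0 < u" "u < s"
          have at_u: "at u within {0..} = at u"
            using u by (intro at_within_interior) simp
          show "((\<lambda>t. I y t - I z t) has_vector_derivative
              (g (x0 + exp (a * u) *\<^sub>R apply_bcontfun y u) - g (x0 + exp (a * u) *\<^sub>R apply_bcontfun z u))) (at u)"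
            using I_deriv[of u y] I_deriv[of u z] u at_u by (auto intro!: has_vector_derivative_diff)
          show "((\<lambda>t. L * dist y z * (exp (a * t) / a)) has_vector_derivative
              L * dist y z * exp (a * u)) (at u)"
            unfolding has_real_derivative_iff_has_vector_derivative[symmetric]
            using a by (auto intro!: derivative_eq_intros simp: field_simps)
          have "norm (g (x0 + exp (a * u) *\<^sub>R apply_bcontfun y u) - g (x0 + exp (a * u) *\<^sub>R apply_bcontfun z u))
             \<le> L * norm (exp (a * u) *\<^sub>R apply_bcontfun y u - exp (a * u) *\<^sub>R apply_bcontfun z u)"
            using lipschitz_onD[OF assms, of "x0 + exp (a * u) *\<^sub>R apply_bcontfun y u" 
              "x0 + exp (a * u) *\<^sub>R apply_bcontfun z u"] by (simp add: dist_norm)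
          also have "\<dots> = L * (exp (a * u) * dist (apply_bcontfun y u) (apply_bcontfun z u))"
            by (simp add: dist_norm flip: scaleR_diff_right)
          also have "\<dots> \<le> L * (exp (a * u) * dist y z)"
            using L by (intro mult_left_mono dist_bounded) auto
          finally show "norm (g (x0 + exp (a * u) *\<^sub>R apply_bcontfun y u) - g (x0 + exp (a * u) *\<^sub>R apply_bcontfun z u))
            \<le> L * dist y z * exp (a * u)" by (simp add: algebra_simps)
        qed
      qed simp
      then show ?thesis by (simp add: I_def algebra_simps)
    qed
    also have "\<dots> \<le> L * dist y z * (exp (a * s) / a)"
      using a L by (intro mult_left_mono) auto
    finally have "norm (I y s - I z s) \<le> L * dist y z * (exp (a * s) / a)" .
    then have "exp (- a * s) * norm (I y s - I z s) \<le> exp (- a * s) * (L * dist y z * (exp (a * s) / a))"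
      by (intro mult_left_mono) auto
    also have "\<dots> = (L / a) * dist y z" by (simp add: exp_minus field_simps)
    also have "\<dots> \<le> 1/2 * dist y z" using a by (intro mult_right_mono) auto
    finally show ?thesis by (simp add: P_def s_def flip: scaleR_diff_right)
  qed
  have P0: "norm (P 0 t) \<le> norm (g x0) / a" for t
  proof -
    define s where "s = max t 0"
    have s: "0 \<le> s" by (simp add: s_def)
    have "a * s \<le> exp (a * s)" using exp_ge_add_one_self[of "a * s"] by linarith
    then have "exp (- a * s) * s \<le> 1 / a" using a by (simp add: exp_minus field_simps)
    then have "exp (- a * s) * s * norm (g x0) \<le> 1 / a * norm (g x0)"
      by (rule mult_right_mono) simp
    then show ?thesis using s by (simp add: P_def I_def s_def)
  qed
  have P_bcont: "P y \<in> bcontfun" for y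
  proof (rule bcontfun_normI)
    show "continuous_on UNIV (P y)" by (rule P_cont)
    show "norm (P y t) \<le> norm (g x0) / a + 1/2 * dist y 0" for t
      using P_diff[of y t 0] P0[of t] norm_triangle_sub[of "P y t" "P 0 t"] by linarith
  qed
  have "\<exists>!y. Bcontfun (P y) = y"
  proof (rule banach_fix_type[of "1/2"])
    show "\<forall>x y. dist (Bcontfun (P x)) (Bcontfun (P y)) \<le> 1/2 * dist x y"
      using P_diff by (intro allI dist_bound) (simp add: Bcontfun_inverse[OF P_bcont] dist_norm)
  qed auto
  then obtain y where "Bcontfun (P y) = y" by blast
  then have fix_y: "apply_bcontfun y t = P y t" for t
    by (metis Bcontfun_inverse[OF P_bcont])
  define x where "x t = x0 + exp (a * t) *\<^sub>R apply_bcontfun y t" for t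
  have x: "x t = x0 + I y t" if "0 \<le> t" for t
    using that by (simp add: x_def fix_y P_def mult_exp_exp)
  have "(x has_vector_derivative g (x t)) (at t within {0..})" if "0 \<le> t" for t
  proof -
    have "((\<lambda>t. x0 + I y t) has_vector_derivative g (x t)) (at t within {0..})"
      using has_vector_derivative_add[OF has_vector_derivative_const I_deriv[OF that]]
      by (simp add: x_def)
    then show ?thesis
      by (rule has_vector_derivative_transform[rotated 2]) (auto simp: that x)
  qed
  moreover have "x 0 = x0" by (simp add: x I_def)
  ultimately show ?thesis by blast
qed

text \<open>
  The distance covered after time \<open>s\<close> is at most the integral of the speed bound over
  \<open>[s, \<infinity>)\<close>.
\<close>

lemma exponential_speed_bound:
  fixes x :: "real \<Rightarrow> 'a::real_normed_vector"
  assumes "0 < c" and st: "0 \<le> s" "s \<le> t" "ereal t < T"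
    and deriv: "\<And>u. 0 \<le> u \<Longrightarrow> ereal u < T \<Longrightarrow>
      (x has_vector_derivative x' u) (at u within {u. 0 \<le> u \<and> ereal u < T})"
    and speed: "\<And>u. 0 \<le> u \<Longrightarrow> ereal u < T \<Longrightarrow> norm (x' u) \<le> A * exp (- c * u)"
  shows "norm (x t - x s) \<le> A / c * exp (- c * s)"
proof -
  let ?J = "{u. 0 \<le> u \<and> ereal u < T}"
  have "0 \<le> A * exp (- c * s)"
    using speed[of s] st by (smt (verit) ereal_less_eq(3) norm_ge_zero order_le_less_trans)
  then have A: "0 \<le> A" by (simp add: zero_le_mult_iff)
  have sub: "{s..t} \<subseteq> ?J"
    using st by (auto intro: le_less_trans[of _ "ereal t"])
  have "norm (x t - x s) \<le> - A / c * exp (- c * t) - (- A / c * exp (- c * s))"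
  proof (cases "s = t")
    case False
    with st have "s < t" by simp
    then show ?thesis
    proof (rule differentiable_bound_general)
      show "continuous_on {s..t} x"
        using sub deriv
        by (auto simp: continuous_on_eq_continuous_within subset_iff
            intro!: has_vector_derivative_continuous
            has_vector_derivative_within_subset[OF deriv sub])
      show "continuous_on {s..t} (\<lambda>u. - A / c * exp (- c * u))"
        by (intro continuous_intros)
      fix u assume u: "s < u" "u < t"
      have "u \<in> interior ?J"
        using u interior_mono[OF sub] by (auto simp: interior_atLeastAtMost_real)
      moreover have "u \<in> ?J" using u by (intro subsetD[OF sub]) simp
      ultimately show "(x has_vector_derivative x' u) (at u)"
        using deriv[of u] at_within_interior[of u ?J] by (metis (mono_tags, lifting) mem_Collect_eq)
      show "norm (x' u) \<le> A * exp (- c * u)" using speed[of u] \<open>u \<in> ?J\<close> by simp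
      show "((\<lambda>u. - A / c * exp (- c * u)) has_vector_derivative A * exp (- c * u)) (at u)"
        unfolding has_real_derivative_iff_has_vector_derivative[symmetric]
        using \<open>0 < c\<close> by (auto intro!: derivative_eq_intros)
    qed
  qed simp
  also have "\<dots> \<le> A / c * exp (- c * s)"
    using A \<open>0 < c\<close> by simp
  finally show ?thesis .
qed

text \<open>
  Continuation argument: a curve that, for as long as it is inside a ball, can move only by
  \<open>\<rho>\<close> from its starting point, and whose starting point is more than \<open>\<rho>\<close> away from the
  boundary, never leaves. At a first exit time \<open>T\<close> the bound would extend to \<open>T\<close> by continuity.
\<close>

lemma stays_in_ball:
  fixes x :: "real \<Rightarrow> 'a::metric_space"
  assumes cont: "continuous_on {0..} x"
    and start: "dist (x 0) z + \<rho> < r" "0 \<le> \<rho>"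
    and confined: "\<And>T t. (\<And>s. 0 \<le> s \<Longrightarrow> s < T \<Longrightarrow> x s \<in> ball z r) \<Longrightarrow>
      0 \<le> t \<Longrightarrow> t < T \<Longrightarrow> dist (x t) (x 0) \<le> \<rho>"
    and "0 \<le> t"
  shows "x t \<in> ball z r"
proof (rule ccontr)
  define B where "B = {s \<in> {0..}. x s \<in> - ball z r}"
  assume "x t \<notin> ball z r"
  then have ne: "B \<noteq> {}" using \<open>0 \<le> t\<close> by (auto simp: B_def)
  have bdd: "bdd_below B" by (auto simp: B_def bdd_below_def)
  have "closed B"
  proof -
    have "B = {0..} \<inter> x -` (- ball z r)" by (auto simp: B_def)
    then show ?thesis
      using continuous_closed_preimage[OF cont closed_atLeast, of "- ball z r"] by (simp add: closed_Compl)
  qed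
  define T where "T = Inf B"
  have "T \<in> B" unfolding T_def by (rule closed_contains_Inf[OF ne bdd \<open>closed B\<close>])
  then have T: "0 \<le> T" "x T \<notin> ball z r" by (auto simp: B_def)
  have before: "x s \<in> ball z r" if "0 \<le> s" "s < T" for s
    using that cInf_lower[OF _ bdd, of s] by (force simp: B_def T_def)
  have "T \<noteq> 0" using T start by (auto simp: dist_commute)
  then have "0 < T" using T by simp
  have "dist (x T) (x 0) \<le> \<rho>"
  proof (rule tendsto_upperbound)
    have "(x \<longlongrightarrow> x T) (at T within {0..})"
      using cont T by (auto simp: continuous_on_def)
    then have "(x \<longlongrightarrow> x T) (at T within {0..<T})"
      by (rule tendsto_within_subset) auto
    then show "((\<lambda>s. dist (x s) (x 0)) \<longlongrightarrow> dist (x T) (x 0)) (at T within {0..<T})"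
      by (intro tendsto_intros)
    show "\<forall>\<^sub>F s in at T within {0..<T}. dist (x s) (x 0) \<le> \<rho>"
      unfolding eventually_at_filter by (rule always_eventually) (auto intro: confined before)
    show "at T within {0..<T} \<noteq> bot"
      using \<open>0 < T\<close> by (simp add: at_within_eq_bot_iff closure_greaterThanLessThan)
  qed
  then show False
    using start T dist_triangle[of "x T" z "x 0"] by (simp add: dist_commute)
qed

lemma exponential_limit:
  fixes x :: "real \<Rightarrow> 'a::banach"
  assumes "0 < c" and "\<And>s t. 0 \<le> s \<Longrightarrow> s \<le> t \<Longrightarrow> norm (x t - x s) \<le> A * exp (- c * s)"
  obtains q where "\<And>s. 0 \<le> s \<Longrightarrow> norm (x s - q) \<le> A * exp (- c * s)"
    and "(\<lambda>n. x (real n)) \<longlonglongrightarrow> q"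
proof -
  have "(\<lambda>n. exp (- c) ^ n) \<longlonglongrightarrow> 0"
    using \<open>0 < c\<close> by (intro LIMSEQ_power_zero) simp
  then have "(\<lambda>n. exp (- c * real n)) \<longlonglongrightarrow> 0"
    by (simp add: exp_of_nat_mult[symmetric] mult.commute)
  then have null: "(\<lambda>n. A * exp (- c * real n)) \<longlonglongrightarrow> 0"
    by (rule tendsto_mult_right_zero)
  have "Cauchy (\<lambda>n. x (real n))"
  proof (rule CauchyI')
    fix e :: real assume "0 < e"
    then obtain N where N: "\<And>n. N \<le> n \<Longrightarrow> A * exp (- c * real n) < e"
      using LIMSEQ_D[OF null \<open>0 < e\<close>] by (auto simp: abs_less_iff)
    show "\<exists>N. \<forall>m\<ge>N. \<forall>n>m. dist (x (real m)) (x (real n)) < e"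
    proof (intro exI allI impI)
      fix m n assume "N \<le> m" "m < n"
      then show "dist (x (real m)) (x (real n)) < e"
        using assms(2)[of "real m" "real n"] N[of m] by (simp add: dist_norm norm_minus_commute)
    qed
  qed
  then obtain q where q: "(\<lambda>n. x (real n)) \<longlonglongrightarrow> q" using Cauchy_convergent convergentD by blast
  have "norm (x s - q) \<le> A * exp (- c * s)" if "0 \<le> s" for s
  proof (rule tendsto_upperbound)
    show "(\<lambda>n. norm (x s - x (real n))) \<longlonglongrightarrow> norm (x s - q)"
      by (intro tendsto_intros q)
    show "\<forall>\<^sub>F n in sequentially. norm (x s - x (real n)) \<le> A * exp (- c * s)"
      using eventually_ge_at_top[of "nat \<lceil>s\<rceil>"]
    proof eventually_elim
      case (elim n)
      then have "s \<le> real n" by linarith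
      then show ?case using assms(2)[OF that, of "real n"] by (simp add: norm_minus_commute)
    qed
  qed simp
  then show thesis using that q by blast
qed

section \<open>The closed loop near the target\<close>

text \<open>
  The state space is locally the graph of the distance map over an open set of configurations, by
  openness of the regular values. Hence the closed loop is an ordinary differential equation
  for \<open>p\<close> alone near the target, with a Lipschitz right-hand side given by a smooth extension
  of \<open>\<nu>\<close>.
\<close>

lemma controller_lipschitz_near:
  fixes \<nu> :: "('d::finite, 'v::{finite,linorder}) config \<times> 'v meas \<Rightarrow> 'v meas \<Rightarrow>\<^sub>L ('d, 'v) config"
  assumes "openin (top_of_set (state_space E)) V" "smooth_on V \<nu>"
    and p_in: "(p, dist_map E p) \<in> V" and "open N" "p \<in> N"
  shows "\<exists>r M L. 0 < r \<and> 0 < M \<and> cball p r \<subseteq> N \<and>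
    (\<forall>q\<in>cball p r. (q, dist_map E q) \<in> V \<and> norm (\<nu> (q, dist_map E q)) \<le> M) \<and>
    L-lipschitz_on (cball p r) (\<lambda>q. blinfun_apply (\<nu> (q, dist_map E q)) (a - dist_map E q))"
proof -
  let ?s = "\<lambda>q. (q, dist_map E q)"
  obtain T where T: "open T" "V = state_space E \<inter> T"
    using assms(1) by (auto simp: openin_open)
  have "dist_map E p \<in> regular_values TYPE('d) E"
    using p_in T by (auto simp: state_space_def)
  from regular_values_relatively_open[OF this]
  obtain R where R: "open R" "dist_map E p \<in> R"
    "\<And>q :: ('d, 'v) config. dist_map E q \<in> R \<Longrightarrow> dist_map E q \<in> regular_values TYPE('d) E"
    by blast
  obtain W g where W: "open W" "?s p \<in> W" "Cinf_on W g" "\<And>y. y \<in> W \<inter> V \<Longrightarrow> g y = \<nu> y"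
    using bspec[OF assms(2)[unfolded smooth_on_def] p_in] by blast
  obtain \<rho> where \<rho>: "0 < \<rho>" "cball (?s p) \<rho> \<subseteq> W"
    using W(1,2) open_contains_cball by blast
  have "Ck_on 1 W g" using W(3) unfolding Cinf_on_def by blast
  from C1_lipschitz_on_cball[OF this \<rho>(2)]
  obtain Lg where Lg: "Lg-lipschitz_on (cball (?s p) \<rho>) g" by blast
  then have "0 \<le> Lg" by (rule lipschitz_on_nonneg)
  define M where "M = norm (g (?s p)) + Lg * \<rho> + 1"
  have "0 < M" using \<open>0 \<le> Lg\<close> \<rho>(1) by (simp add: M_def add_nonneg_pos)
  have M: "norm (g y) \<le> M" if "y \<in> cball (?s p) \<rho>" for y
  proof -
    have "dist (g y) (g (?s p)) \<le> Lg * dist y (?s p)"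
      using Lg that \<rho>(1) by (intro lipschitz_onD[OF Lg]) auto
    also have "\<dots> \<le> Lg * \<rho>"
      using \<open>0 \<le> Lg\<close> that by (intro mult_left_mono) (auto simp: dist_commute)
    finally show ?thesis
      using norm_triangle_sub[of "g y" "g (?s p)"] by (simp add: M_def dist_norm)
  qed
  have "open (?s -` (T \<inter> ball (?s p) \<rho>) \<inter> dist_map E -` R \<inter> N)"
    using T(1) R(1) \<open>open N\<close>
    by (intro open_Int open_vimage continuous_intros continuous_on_dist_map) auto
  moreover have "p \<in> ?s -` (T \<inter> ball (?s p) \<rho>) \<inter> dist_map E -` R \<inter> N"
    using T p_in R \<rho> \<open>p \<in> N\<close> by auto
  ultimately obtain r where r: "0 < r"
    "cball p r \<subseteq> ?s -` (T \<inter> ball (?s p) \<rho>) \<inter> dist_map E -` R \<inter> N"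
    using open_contains_cball by blast
  have in_V: "?s q \<in> V" if "q \<in> cball p r" for q
  proof -
    have "dist_map E q \<in> R" "?s q \<in> T" using that r(2) by blast+
    then show ?thesis using R(3) T(2) by (auto simp: state_space_def regular_configs_def)
  qed
  have in_ball: "?s q \<in> cball (?s p) \<rho>" if "q \<in> cball p r" for q
    using that r(2) ball_subset_cball by blast
  have g_eq: "g (?s q) = \<nu> (?s q)" if "q \<in> cball p r" for q
    using W(4) in_V in_ball that \<rho>(2) by blast
  obtain LF where LF: "LF-lipschitz_on (cball p r) (dist_map E)"
    using dist_map_lipschitz_on_cball by blast
  have "(Lg * (1 + LF))-lipschitz_on (cball p r) (\<lambda>q. \<nu> (?s q))"
  proof (rule lipschitz_onI)
    have "0 \<le> LF" using LF by (rule lipschitz_on_nonneg)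
    then show "0 \<le> Lg * (1 + LF)" using \<open>0 \<le> Lg\<close> by simp
    fix x y assume x: "x \<in> cball p r" and y: "y \<in> cball p r"
    have "dist (?s x) (?s y) \<le> dist x y + dist (dist_map E x) (dist_map E y)"
      by (simp add: dist_Pair_Pair sqrt_sum_squares_le_sum)
    also have "\<dots> \<le> (1 + LF) * dist x y"
      using lipschitz_onD[OF LF x y] by (simp add: algebra_simps)
    finally have "Lg * dist (?s x) (?s y) \<le> Lg * ((1 + LF) * dist x y)"
      using \<open>0 \<le> Lg\<close> by (rule mult_left_mono)
    then show "dist (\<nu> (?s x)) (\<nu> (?s y)) \<le> Lg * (1 + LF) * dist x y"
      using lipschitz_onD[OF Lg in_ball[OF x] in_ball[OF y]] g_eq x y by (simp add: algebra_simps)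
  qed
  moreover have "norm (\<nu> (?s q)) \<le> M" if "q \<in> cball p r" for q
    using M[OF in_ball[OF that]] g_eq[OF that] by simp
  moreover have "LF-lipschitz_on (cball p r) (\<lambda>q. a - dist_map E q)"
    using LF by (auto simp: lipschitz_on_def dist_norm norm_minus_commute)
  moreover have "norm (a - dist_map E q) \<le> norm (a - dist_map E p) + \<rho>" if "q \<in> cball p r" for q
  proof -
    have "dist (dist_map E p) (dist_map E q) \<le> \<rho>"
      using in_ball[OF that] dist_snd_le[of "?s p" "?s q"] by simp
    then show ?thesis
      using norm_triangle_ineq[of "a - dist_map E p" "dist_map E p - dist_map E q"]
      by (simp add: dist_norm)
  qed
  ultimately have "(Lg * (1 + LF) * (norm (a - dist_map E p) + \<rho>) + M * LF)-lipschitz_on (cball p r)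
      (\<lambda>q. blinfun_apply (\<nu> (?s q)) (a - dist_map E q))"
    using \<open>0 < M\<close> \<rho>(1) by (intro lipschitz_on_blinfun_apply) auto
  then show ?thesis
    using r \<open>0 < M\<close> in_V M g_eq in_ball
    by (intro exI[of _ r] exI[of _ M] exI conjI ballI) (auto simp: g_eq[symmetric])
qed

lemma edge_space_diff_dist_map: "dist_map E p - dist_map E q \<in> edge_space E"
  by (simp add: edge_space_def dist_map_def)

text \<open>
  Compatibility makes the measurement equation a consequence of the configuration equation.
\<close>

lemma closed_loop_solutionI:
  assumes compat: "compatible_controller E V \<nu> \<eta>"
    and V: "\<And>t. 0 \<le> t \<Longrightarrow> ereal t < T \<Longrightarrow> (p t, dist_map E (p t)) \<in> V"
    and deriv: "\<And>t. 0 \<le> t \<Longrightarrow> ereal t < T \<Longrightarrow> (p has_vector_derivative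
      blinfun_apply (\<nu> (p t, dist_map E (p t))) (dist_map E q - dist_map E (p t)))
      (at t within {t. 0 \<le> t \<and> ereal t < T})"
  shows "closed_loop_solution \<nu> \<eta> V (dist_map E q) T p (\<lambda>t. dist_map E (p t))"
  unfolding closed_loop_solution_def
proof (intro ballI conjI)
  fix t assume "t \<in> {t. 0 \<le> t \<and> ereal t < T}"
  then have t: "0 \<le> t" "ereal t < T" by auto
  show "(p t, dist_map E (p t)) \<in> V" using V t by blast
  show "(p has_vector_derivative
      blinfun_apply (\<nu> (p t, dist_map E (p t))) (dist_map E q - dist_map E (p t)))
      (at t within {t. 0 \<le> t \<and> ereal t < T})"
    using deriv t by blast
  let ?s = "(p t, dist_map E (p t))" and ?x = "dist_map E q - dist_map E (p t)"
  let ?D = "\<lambda>x. 2 *\<^sub>R rigidity E (p t) x"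
  have D: "(dist_map E has_derivative ?D) (at (p t))" by (rule dist_map_has_derivative)
  have "(blinfun_apply (\<nu> ?s) ?x, blinfun_apply (\<eta> ?s) ?x) \<in> tangent_space (state_space E) ?s"
    using compat V[OF t] edge_space_diff_dist_map unfolding compatible_controller_def by blast
  then have "blinfun_apply (\<eta> ?s) ?x = ?D (blinfun_apply (\<nu> ?s) ?x)"
    by (rule tangent_state_space) (simp add: D)
  then show "((\<lambda>t. dist_map E (p t)) has_vector_derivative blinfun_apply (\<eta> ?s) ?x)
      (at t within {t. 0 \<le> t \<and> ereal t < T})"
    using vector_derivative_diff_chain_within[OF deriv[OF t] has_derivative_at_withinI[OF D]]
    by (simp add: comp_def)
qed

lemma closed_loop_solution_restrict:
  assumes "closed_loop_solution \<nu> \<eta> V a T p m" and "T' \<le> T"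
  shows "closed_loop_solution \<nu> \<eta> V a T' p m"
proof -
  have sub: "{t. 0 \<le> t \<and> ereal t < T'} \<subseteq> {t. 0 \<le> t \<and> ereal t < T}"
    using assms(2) by auto
  show ?thesis
    using assms(1) sub unfolding closed_loop_solution_def
    by (meson has_vector_derivative_within_subset subsetD)
qed

text \<open>
  The speed is at most \<open>M\<close> times the measurement error, which decays exponentially.
\<close>

lemma closed_loop_travel_bound:
  assumes sol: "closed_loop_solution \<nu> \<eta> V a T p m"
    and "0 < c" "0 \<le> M"
    and bound: "\<And>t. 0 \<le> t \<Longrightarrow> ereal t < T \<Longrightarrow> norm (\<nu> (p t, m t)) \<le> M"
    and decay: "\<And>t. 0 \<le> t \<Longrightarrow> ereal t < T \<Longrightarrow>
      norm (m t - a) \<le> C * exp (- c * t) * norm (m 0 - a)"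
    and st: "0 \<le> s" "s \<le> t" "ereal t < T"
  shows "norm (p t - p s) \<le> M * C / c * exp (- c * s) * norm (m 0 - a)"
proof -
  have "norm (p t - p s) \<le> (M * C * norm (m 0 - a)) / c * exp (- c * s)"
  proof (rule exponential_speed_bound[OF \<open>0 < c\<close> st])
    fix u assume u: "0 \<le> u" "ereal u < T"
    then show "(p has_vector_derivative blinfun_apply (\<nu> (p u, m u)) (a - m u))
        (at u within {u. 0 \<le> u \<and> ereal u < T})"
      using sol by (simp add: closed_loop_solution_def)
    have "norm (blinfun_apply (\<nu> (p u, m u)) (a - m u)) \<le> norm (\<nu> (p u, m u)) * norm (a - m u)"
      by (rule norm_blinfun)
    also have "\<dots> \<le> M * (C * exp (- c * u) * norm (m 0 - a))"
      using bound[OF u] decay[OF u] \<open>0 \<le> M\<close>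
      by (intro mult_mono) (auto simp: norm_minus_commute)
    finally show "norm (blinfun_apply (\<nu> (p u, m u)) (a - m u)) \<le> M * C * norm (m 0 - a) * exp (- c * u)"
      by (simp add: algebra_simps)
  qed
  then show ?thesis by (simp add: algebra_simps)
qed

section \<open>Exponential stability of rigid formations\<close>

theorem mainTheorem1:
  fixes E :: "('v::{finite,linorder} \<times> 'v) set"
    and pstar :: "('d::finite, 'v) config"
    and mstar :: "'v meas"
    and V :: "(('d, 'v) config \<times> 'v meas) set"
    and \<nu> :: "('d, 'v) config \<times> 'v meas \<Rightarrow> 'v meas \<Rightarrow>\<^sub>L ('d, 'v) config"
    and \<eta> :: "('d, 'v) config \<times> 'v meas \<Rightarrow> 'v meas \<Rightarrow>\<^sub>L 'v meas"
    and C c :: real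
  assumes "simple_graph E"
    and "rigid_graph TYPE('d) E"
    and "pstar \<in> regular_configs E"
    and "mstar = dist_map E pstar"
    and "openin (top_of_set (state_space E)) V"
    and "(pstar, mstar) \<in> V"
    and "compatible_controller E V \<nu> \<eta>"
    and "0 < C" and "0 < c"
    and decay: "\<And>T p m. 0 < T \<Longrightarrow> closed_loop_solution \<nu> \<eta> V mstar T p m \<Longrightarrow>
      (\<forall>t. 0 \<le> t \<and> ereal t < T \<longrightarrow>
         norm (m t - mstar) \<le> C * exp (- c * t) * norm (m 0 - mstar))"
  shows "(\<exists>U K. openin (top_of_set (state_space E)) U \<and> (pstar, mstar) \<in> U \<and> U \<subseteq> V \<and> 0 < K \<and>
      (\<forall>(p0, m0) \<in> U.
         (\<exists>p m. closed_loop_solution \<nu> \<eta> V mstar \<infinity> p m \<and> p 0 = p0 \<and> m 0 = m0) \<and>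
         (\<forall>p m. closed_loop_solution \<nu> \<eta> V mstar \<infinity> p m \<and> p 0 = p0 \<and> m 0 = m0 \<longrightarrow>
            (\<exists>q. congruent_config pstar q \<and>
               (\<forall>t\<ge>0. norm (p t - q) \<le> K * exp (- c * t) * norm (m0 - mstar)))))) \<and>
    locally_exp_stable E V \<nu> \<eta> pstar"
proof -
  let ?F = "dist_map E :: ('d, 'v) config \<Rightarrow> 'v meas"
  note mstar = \<open>mstar = dist_map E pstar\<close>
  obtain N where N: "open N" "pstar \<in> N"
    and rigid: "\<And>q. q \<in> N \<Longrightarrow> ?F q = mstar \<Longrightarrow> congruent_config pstar q"
    using bspec[OF assms(2)[unfolded rigid_graph_def] assms(3)] mstar by metis
  have "smooth_on V \<nu>" using assms(7) by (simp add: compatible_controller_def)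
  from controller_lipschitz_near[OF assms(5) this _ N, of mstar]
  obtain r M L where r: "0 < r" "cball pstar r \<subseteq> N" and "0 < M"
    and in_V: "\<And>q. q \<in> cball pstar r \<Longrightarrow> (q, ?F q) \<in> V"
    and M: "\<And>q. q \<in> cball pstar r \<Longrightarrow> norm (\<nu> (q, ?F q)) \<le> M"
    and L: "L-lipschitz_on (cball pstar r) (\<lambda>q. blinfun_apply (\<nu> (q, ?F q)) (mstar - ?F q))"
    using assms(6) unfolding mstar by blast
  \<comment> \<open>\<open>K * norm (m0 - mstar)\<close> bounds the length of a trajectory that stays in the ball.\<close>
  define K where "K = M * C / c"
  have "0 < K" using \<open>0 < M\<close> assms(8,9) by (simp add: K_def)
  \<comment> \<open>A starting point may not be so far from the target that the trajectory could reach the boundary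
    of the ball. The set is chosen so that it also contains the limits: at a configuration with
    measurement \<open>mstar\<close> the second summand vanishes.\<close>
  define U' where "U' = {p. dist p pstar + K * norm (?F p - mstar) < r}"
  have "open U'"
    unfolding U'_def by (intro open_Collect_less continuous_intros continuous_on_dist_map)
  have "pstar \<in> U'" using r by (simp add: U'_def mstar)
  have U'_cball: "p \<in> cball pstar r" if "p \<in> U'" for p
  proof -
    have "0 \<le> K * norm (?F p - mstar)" using \<open>0 < K\<close> by simp
    then show ?thesis using that unfolding U'_def by (simp add: dist_commute)
  qed
  have m_eq: "m t = ?F (p t)"
    if "closed_loop_solution \<nu> \<eta> V mstar T p m" "0 \<le> t" "ereal t < T" for T p m t
    using that openin_imp_subset[OF assms(5)]
    by (force simp: closed_loop_solution_def state_space_def)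
  have travel: "norm (p t - p s) \<le> K * exp (- c * s) * norm (m 0 - mstar)"
    if sol: "closed_loop_solution \<nu> \<eta> V mstar T p m"
      and ball: "\<And>u. 0 \<le> u \<Longrightarrow> ereal u < T \<Longrightarrow> p u \<in> ball pstar r"
      and st: "0 \<le> s" "s \<le> t" "ereal t < T" for T p m s t
    unfolding K_def
  proof (rule closed_loop_travel_bound[OF sol \<open>0 < c\<close> _ _ _ st])
    have "0 < T" using st by (metis ereal_less_eq(3) order_trans order_le_less_trans zero_ereal_def)
    then show "norm (m u - mstar) \<le> C * exp (- c * u) * norm (m 0 - mstar)"
      if "0 \<le> u" "ereal u < T" for u
      using decay sol that by blast
    show "norm (\<nu> (p u, m u)) \<le> M" if "0 \<le> u" "ereal u < T" for u
      using M[of "p u"] ball[OF that] m_eq[OF sol that] by (simp add: less_imp_le)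
  qed (use \<open>0 < M\<close> in simp)
  \<comment> \<open>Stated for curves that solve the closed loop only while inside the ball, to apply both to given
    solutions and to solutions of the equation extended beyond the ball.\<close>
  have stays: "p t \<in> ball pstar r"
    if "p 0 \<in> U'" "continuous_on {0..} p" "0 \<le> t"
      and sol: "\<And>T. (\<And>u. 0 \<le> u \<Longrightarrow> u < T \<Longrightarrow> p u \<in> ball pstar r) \<Longrightarrow> 0 < T \<Longrightarrow>
        closed_loop_solution \<nu> \<eta> V mstar (ereal T) p m"
    for p m and t :: real
  proof (rule stays_in_ball[OF that(2) _ _ _ that(3)])
    show "dist (p 0) pstar + K * norm (?F (p 0) - mstar) < r" using that(1) by (simp add: U'_def)
    show "0 \<le> K * norm (?F (p 0) - mstar)" using \<open>0 < K\<close> by simp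
    fix T t :: real
    assume ball: "\<And>u. 0 \<le> u \<Longrightarrow> u < T \<Longrightarrow> p u \<in> ball pstar r" and t: "0 \<le> t" "t < T"
    then have "closed_loop_solution \<nu> \<eta> V mstar (ereal T) p m" by (intro sol) auto
    from travel[OF this _ order_refl t(1)] m_eq[OF this order_refl]
    show "dist (p t) (p 0) \<le> K * norm (?F (p 0) - mstar)"
      using ball t by (simp add: dist_norm)
  qed
  have exist: "\<exists>p m. closed_loop_solution \<nu> \<eta> V mstar \<infinity> p m \<and> p 0 = p0 \<and> m 0 = ?F p0"
    if p0: "p0 \<in> U'" for p0
  proof -
    define h where "h x = blinfun_apply (\<nu> (x, ?F x)) (mstar - ?F x)" for x
    have cb: "closest_point (cball pstar r) x \<in> cball pstar r" for x
      using r(1) by (intro closest_point_in_set) auto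
    \<comment> \<open>The field is continued to all configurations by composing it with the nearest-point projection
      to the ball, which does not increase distances.\<close>
    have "L-lipschitz_on UNIV (\<lambda>x. h (closest_point (cball pstar r) x))"
    proof (rule lipschitz_onI)
      show "0 \<le> L" using L by (rule lipschitz_on_nonneg)
      fix x y
      have "dist (h (closest_point (cball pstar r) x)) (h (closest_point (cball pstar r) y))
          \<le> L * dist (closest_point (cball pstar r) x) (closest_point (cball pstar r) y)"
        unfolding h_def by (rule lipschitz_onD[OF L cb cb])
      also have "\<dots> \<le> L * dist x y"
        using r(1) \<open>0 \<le> L\<close> by (intro mult_left_mono closest_point_lipschitz) auto
      finally show "dist (h (closest_point (cball pstar r) x)) (h (closest_point (cball pstar r) y))
        \<le> L * dist x y" .
    qed
    from lipschitz_ode_global_solution[OF this, of p0]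
    obtain x where x: "x 0 = p0" "\<And>t. 0 \<le> t \<Longrightarrow>
        (x has_vector_derivative h (closest_point (cball pstar r) (x t))) (at t within {0..})"
      by blast
    have sol: "closed_loop_solution \<nu> \<eta> V mstar T x (\<lambda>t. ?F (x t))"
      if ball: "\<And>u. 0 \<le> u \<Longrightarrow> ereal u < T \<Longrightarrow> x u \<in> ball pstar r" for T
      unfolding mstar
    proof (rule closed_loop_solutionI[OF assms(7)])
      fix t assume t: "0 \<le> t" "ereal t < T"
      have xt: "x t \<in> cball pstar r" using ball[OF t] ball_subset_cball by blast
      then show "(x t, ?F (x t)) \<in> V" by (rule in_V)
      have "(x has_vector_derivative h (x t)) (at t within {0..})"
        using x(2)[OF t(1)] closest_point_self[OF xt] by simp
      then show "(x has_vector_derivative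
          blinfun_apply (\<nu> (x t, ?F (x t))) (?F pstar - ?F (x t))) (at t within {t. 0 \<le> t \<and> ereal t < T})"
        unfolding h_def mstar by (rule has_vector_derivative_within_subset) auto
    qed
    have "continuous_on {0..} x"
      by (auto simp: continuous_on_eq_continuous_within intro!: has_vector_derivative_continuous x(2))
    then have "x t \<in> ball pstar r" if "0 \<le> t" for t
      using p0 x(1) that by (intro stays[of x t "\<lambda>t. ?F (x t)"] sol) auto
    then show ?thesis using sol[of \<infinity>] x(1) by blast
  qed
  have converge: "\<exists>q\<in>U'. congruent_config pstar q \<and>
      (\<forall>t\<ge>0. norm (p t - q) \<le> K * exp (- c * t) * norm (?F (p 0) - mstar))"
    if p0: "p 0 \<in> U'" and sol: "closed_loop_solution \<nu> \<eta> V mstar \<infinity> p m" for p m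
  proof -
    have m: "m t = ?F (p t)" if "0 \<le> t" for t using m_eq[OF sol that] by simp
    have "(p has_vector_derivative blinfun_apply (\<nu> (p t, m t)) (mstar - m t)) (at t within {0..})"
      if "0 \<le> t" for t
      using sol that by (simp add: closed_loop_solution_def atLeast_def)
    then have "continuous_on {0..} p"
      by (auto simp: continuous_on_eq_continuous_within intro: has_vector_derivative_continuous)
    then have ball: "p t \<in> ball pstar r" if "0 \<le> t" for t
      using p0 that sol by (intro stays[of p t m] closed_loop_solution_restrict[OF sol]) auto
    have tr: "norm (p t - p s) \<le> (K * norm (?F (p 0) - mstar)) * exp (- c * s)"
      if "0 \<le> s" "s \<le> t" for s t
      using travel[OF sol ball that] m by (simp add: algebra_simps)
    obtain q where q: "\<And>s. 0 \<le> s \<Longrightarrow> norm (p s - q) \<le> K * norm (?F (p 0) - mstar) * exp (- c * s)"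
      and lim: "(\<lambda>n. p (real n)) \<longlonglongrightarrow> q"
      using exponential_limit[OF \<open>0 < c\<close> tr] by blast
    have "(\<lambda>n. ?F (p (real n))) \<longlonglongrightarrow> ?F q"
      using continuous_on_tendsto_compose[OF continuous_on_dist_map lim, of UNIV] by simp
    moreover have "(\<lambda>n. ?F (p (real n))) \<longlonglongrightarrow> mstar"
    proof (rule LIM_zero_cancel, rule Lim_null_comparison)
      show "\<forall>\<^sub>F n in sequentially. norm (?F (p (real n)) - mstar) \<le> C * norm (m 0 - mstar) * exp (- c) ^ n"
      proof (intro always_eventually allI)
        fix n
        have "norm (m (real n) - mstar) \<le> C * exp (- c * real n) * norm (m 0 - mstar)"
          using decay[OF _ sol] by simp
        then show "norm (?F (p (real n)) - mstar) \<le> C * norm (m 0 - mstar) * exp (- c) ^ n"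
          by (simp add: m exp_of_nat_mult[symmetric] algebra_simps)
      qed
      have "(\<lambda>n. exp (- c) ^ n) \<longlonglongrightarrow> 0"
        using \<open>0 < c\<close> by (intro LIMSEQ_power_zero) simp
      then show "(\<lambda>n. C * norm (m 0 - mstar) * exp (- c) ^ n) \<longlonglongrightarrow> 0"
        by (rule tendsto_mult_right_zero)
    qed
    ultimately have Fq: "?F q = mstar" by (rule LIMSEQ_unique)
    have "dist q pstar \<le> dist (p 0) q + dist (p 0) pstar" by (rule dist_triangle3)
    also have "dist (p 0) q \<le> K * norm (?F (p 0) - mstar)" using q[of 0] by (simp add: dist_norm)
    finally have "q \<in> U'" using p0 by (simp add: U'_def Fq)
    moreover have "congruent_config pstar q"
      using rigid Fq U'_cball[OF \<open>q \<in> U'\<close>] r(2) by blast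
    ultimately show ?thesis using q by (auto simp: algebra_simps)
  qed
  define U where "U = V \<inter> U' \<times> UNIV"
  have "openin (top_of_set (state_space E)) U"
    unfolding U_def by (intro openin_Int_open assms(5) open_Times \<open>open U'\<close> open_UNIV)
  moreover have "(pstar, mstar) \<in> U" using \<open>pstar \<in> U'\<close> assms(6) by (simp add: U_def)
  moreover have "U \<subseteq> V" by (simp add: U_def)
  moreover have "\<forall>(p0, m0) \<in> U.
         (\<exists>p m. closed_loop_solution \<nu> \<eta> V mstar \<infinity> p m \<and> p 0 = p0 \<and> m 0 = m0) \<and>
         (\<forall>p m. closed_loop_solution \<nu> \<eta> V mstar \<infinity> p m \<and> p 0 = p0 \<and> m 0 = m0 \<longrightarrow>
            (\<exists>q. congruent_config pstar q \<and>
               (\<forall>t\<ge>0. norm (p t - q) \<le> K * exp (- c * t) * norm (m0 - mstar))))"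
  proof (intro ballI, clarify, intro conjI allI impI)
    fix p0 m0 assume "(p0, m0) \<in> U"
    then have p0: "p0 \<in> U'" "m0 = ?F p0"
      using openin_imp_subset[OF assms(5)] by (auto simp: U_def state_space_def)
    show "\<exists>p m. closed_loop_solution \<nu> \<eta> V mstar \<infinity> p m \<and> p 0 = p0 \<and> m 0 = m0"
      using exist[OF p0(1)] p0(2) by simp
    fix p m assume "closed_loop_solution \<nu> \<eta> V mstar \<infinity> p m \<and> p 0 = p0 \<and> m 0 = m0"
    then show "\<exists>q. congruent_config pstar q \<and>
        (\<forall>t\<ge>0. norm (p t - q) \<le> K * exp (- c * t) * norm (m0 - mstar))"
      using converge[of p m] p0 by blast
  qed
  moreover have "locally_exp_stable E V \<nu> \<eta> pstar"
    unfolding locally_exp_stable_def mstar[symmetric]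
  proof (rule conjI[OF assms(3)], rule exI[of _ U'], rule exI[of _ r], rule exI[of _ c],
      intro conjI ballI allI impI)
    fix p0 assume p0: "p0 \<in> U'"
    show "\<exists>p m. closed_loop_solution \<nu> \<eta> V mstar \<infinity> p m \<and> p 0 = p0 \<and> m 0 = ?F p0"
      by (rule exist[OF p0])
    fix p m assume pm: "closed_loop_solution \<nu> \<eta> V mstar \<infinity> p m \<and> p 0 = p0 \<and> m 0 = ?F p0"
    then obtain q where q: "q \<in> U'" "congruent_config pstar q"
      "\<And>t. 0 \<le> t \<Longrightarrow> norm (p t - q) \<le> K * exp (- c * t) * norm (?F p0 - mstar)"
      using converge[of p m] p0 by blast
    \<comment> \<open>Membership in \<open>U'\<close> bounds the initial error, which makes the constant uniform.\<close>
    have "K * norm (?F p0 - mstar) \<le> r"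
      using p0 zero_le_dist[of p0 pstar] unfolding U'_def mem_Collect_eq by linarith
    then have "K * norm (?F p0 - mstar) * exp (- c * t) \<le> r * exp (- c * t)" for t
      by (rule mult_right_mono) simp
    moreover have "norm (p t - q) \<le> K * norm (?F p0 - mstar) * exp (- c * t)" if "0 \<le> t" for t
      using q(3)[OF that] by (simp add: algebra_simps)
    ultimately have "norm (p t - q) \<le> r * exp (- c * t)" if "0 \<le> t" for t
      using that order_trans by blast
    then show "\<exists>q\<in>U'. congruent_config pstar q \<and> (\<forall>t\<ge>0. norm (p t - q) \<le> r * exp (- c * t))"
      using q by blast
  qed (use assms(9) r \<open>open U'\<close> \<open>pstar \<in> U'\<close> in auto)
  ultimately show ?thesis using \<open>0 < K\<close> by blast
qed

end
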